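(* Every fragment $\Sigma_1,\mathcal{R}_1$ of the system $\mathcal{U}=\Sigma_{\mathcal{U}},\mathcal{R}_{\mathcal{U}}$ (including $\mathcal{U}$ itself) is a theory, that is, $\hookrightarrow_{\beta\mathcal{R}_1}$ is confluent on $\Lambda(\Sigma_1)$ and every rule of $\mathcal{R}_1$ preserves typing in $\Sigma_1,\mathcal{R}_1$.
   Context: Framework: the $\lambda\Pi$-calculus modulo theory. Terms $t ::= c\mid x\mid\mathtt{TYPE}\mid\mathtt{KIND}\mid\Pi x:t.u\mid\lambda x:t.u\mid t\,u$; $A\to B$ abbreviates $\Pi x:A.B$ with $x$ not free in $B$. Rules $\ell\hookrightarrow r$ have $\ell=c\,\ell_1\ldots\ell_n$ ($n\geq0$), free variables of rules act as pattern variables; $\hookrightarrow_{\mathcal{R}}$ is the closure of $\mathcal{R}$ under term constructors and substitution, $\hookrightarrow_{\beta\mathcal{R}}=\hookrightarrow_\beta\cup\hookrightarrow_{\mathcal{R}}$, $\equiv_{\beta\mathcal{R}}$ its equivalence closure. A signature $\Sigma$ is a list of declarations $c:A$ ($A$ closed), $|\Sigma|$ its set of constants, $\Lambda(\Sigma)$ the terms whose constants lie in $|\Sigma|$. Typing (with sorts $s\in\{\mathtt{TYPE},\mathtt{KIND}\}$): (empty) $\vdash[\,]$ wf; (decl) $\Gamma\vdash A:s\Rightarrow\ \vdash\Gamma,x:A$ wf; (sort) $\vdash\Gamma$ wf $\Rightarrow\Gamma\vdash\mathtt{TYPE}:\mathtt{KIND}$; (const) $\vdash\Gamma$ wf, $\vdash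 A:s$, $c:A\in\Sigma\Rightarrow\Gamma\vdash c:A$; (var) $\vdash\Gamma$ wf, $x:A\in\Gamma\Rightarrow\Gamma\vdash x:A$; (prod) $\Gamma\vdash A:\mathtt{TYPE}$, $\Gamma,x:A\vdash B:s\Rightarrow\Gamma\vdash\Pi x:A.B:s$; (abs) $\Gamma\vdash A:\mathtt{TYPE}$, $\Gamma,x:A\vdash B:s$, $\Gamma,x:A\vdash t:B\Rightarrow\Gamma\vdash\lambda x:A.t:\Pi x:A.B$; (app) $\Gamma\vdash t:\Pi x:A.B$, $\Gamma\vdash u:A\Rightarrow\Gamma\vdash t\,u:(u/x)B$; (conv) $\Gamma\vdash t:A$, $\Gamma\vdash B:s$, $A\equiv_{\beta\mathcal{R}}B\Rightarrow\Gamma\vdash t:B$; judgements written $\vdash_{\Sigma,\mathcal{R}}$. A system is a pair $\Sigma,\mathcal{R}$ with all rules in $\Lambda(\Sigma)$. A rule $\ell\hookrightarrow r$ preserves typing in $\Sigma,\mathcal{R}$ if for all contexts $\Gamma$, substitutions $\theta$ and terms $A$ in $\Lambda(\Sigma)$, $\Gamma\vdash_{\Sigma,\mathcal{R}}\theta\ell:A$ implies $\Gamma\vdash_{\Sigma,\mathcal{R}}\theta r:A$. A theory is a system with $\hookrightarrow_{\beta\mathcal{R}}$ confluent on $\Lambda(\Sigma)$ and all rules preserving typing. A fragment $\Sigma_1,\mathcal{R}_1$ of $\Sigma_0,\mathcal{R}_0$: every declaration of $\Sigma_1$ is in $\Sigma_0$, $\mathcal{R}_1\subseteq\mathcal{R}_0$,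 the type of each constant of $\Sigma_1$ has all constants in $|\Sigma_1|$, and every rule of $\mathcal{R}_0$ whose left side has all constants in $|\Sigma_1|$ has its right side with all constants in $|\Sigma_1|$ and belongs to $\mathcal{R}_1$. The system $\mathcal{U}$ has signature $\Sigma_{\mathcal{U}}$ consisting of the following 43 declarations and $\mathcal{R}_{\mathcal{U}}$ of the following 31 rules ($\Rightarrow,\wedge,\vee,\Rightarrow_c,\wedge_c,\vee_c,\leadsto,\leadsto_d,\Rightarrow_d,\rightsquigarrow_d$ written infix): $I:\mathtt{TYPE}$; $\mathit{Set}:\mathtt{TYPE}$; $\mathit{El}:\mathit{Set}\to\mathtt{TYPE}$; $\iota:\mathit{Set}$, $\mathit{El}\,\iota\hookrightarrow I$; $\mathit{Prop}:\mathtt{TYPE}$; $\mathit{Prf}:\mathit{Prop}\to\mathtt{TYPE}$; $\Rightarrow:\mathit{Prop}\to\mathit{Prop}\to\mathit{Prop}$, $\mathit{Prf}(x\Rightarrow y)\hookrightarrow\mathit{Prf}\,x\to\mathit{Prf}\,y$; $\forall:\Pi x:\mathit{Set}.(\mathit{El}\,x\to\mathit{Prop})\to\mathit{Prop}$, $\mathit{Prf}(\forall\,x\,p)\hookrightarrow\Pi z:\mathit{El}\,x.\mathit{Prf}(p\,z)$; $\top:\mathit{Prop}$, $\mathit{Prf}\,\top\hookrightarrow\Pi z:\mathit{Prop}.\mathit{Prf}\,z\to\mathit{Prf}\,z$; $\bot:\mathit{Prop}$, $\mathit{Prf}\,\bot\hookrightarrow\Pi z:\mathit{Prop}.\mathit{Prf}\,z$;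 $\neg:\mathit{Prop}\to\mathit{Prop}$, $\mathit{Prf}(\neg x)\hookrightarrow\mathit{Prf}\,x\to\Pi z:\mathit{Prop}.\mathit{Prf}\,z$; $\wedge:\mathit{Prop}\to\mathit{Prop}\to\mathit{Prop}$, $\mathit{Prf}(x\wedge y)\hookrightarrow\Pi z:\mathit{Prop}.(\mathit{Prf}\,x\to\mathit{Prf}\,y\to\mathit{Prf}\,z)\to\mathit{Prf}\,z$; $\vee:\mathit{Prop}\to\mathit{Prop}\to\mathit{Prop}$, $\mathit{Prf}(x\vee y)\hookrightarrow\Pi z:\mathit{Prop}.(\mathit{Prf}\,x\to\mathit{Prf}\,z)\to(\mathit{Prf}\,y\to\mathit{Prf}\,z)\to\mathit{Prf}\,z$; $\exists:\Pi a:\mathit{Set}.(\mathit{El}\,a\to\mathit{Prop})\to\mathit{Prop}$, $\mathit{Prf}(\exists\,a\,p)\hookrightarrow\Pi z:\mathit{Prop}.(\Pi x:\mathit{El}\,a.\mathit{Prf}(p\,x)\to\mathit{Prf}\,z)\to\mathit{Prf}\,z$; $\mathit{Prf}_c:\mathit{Prop}\to\mathtt{TYPE}$, $\mathit{Prf}_c\hookrightarrow\lambda x:\mathit{Prop}.\mathit{Prf}(\neg\neg x)$; $\Rightarrow_c,\wedge_c,\vee_c:\mathit{Prop}\to\mathit{Prop}\to\mathit{Prop}$ with $\Rightarrow_c\hookrightarrow\lambda x:\mathit{Prop}.\lambda y:\mathit{Prop}.(\neg\neg x)\Rightarrow(\neg\neg y)$ and likewise $\wedge_c\hookrightarrow\lambda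 x.\lambda y.(\neg\neg x)\wedge(\neg\neg y)$, $\vee_c\hookrightarrow\lambda x.\lambda y.(\neg\neg x)\vee(\neg\neg y)$; $\forall_c,\exists_c:\Pi a:\mathit{Set}.(\mathit{El}\,a\to\mathit{Prop})\to\mathit{Prop}$ with $\forall_c\hookrightarrow\lambda a:\mathit{Set}.\lambda p:(\mathit{El}\,a\to\mathit{Prop}).\forall\,a\,(\lambda x:\mathit{El}\,a.\neg\neg(p\,x))$ and $\exists_c\hookrightarrow\lambda a:\mathit{Set}.\lambda p:(\mathit{El}\,a\to\mathit{Prop}).\exists\,a\,(\lambda x:\mathit{El}\,a.\neg\neg(p\,x))$; $o:\mathit{Set}$, $\mathit{El}\,o\hookrightarrow\mathit{Prop}$; $\leadsto:\mathit{Set}\to\mathit{Set}\to\mathit{Set}$, $\mathit{El}(x\leadsto y)\hookrightarrow\mathit{El}\,x\to\mathit{El}\,y$; $\leadsto_d:\Pi x:\mathit{Set}.(\mathit{El}\,x\to\mathit{Set})\to\mathit{Set}$, $\mathit{El}(x\leadsto_d y)\hookrightarrow\Pi z:\mathit{El}\,x.\mathit{El}(y\,z)$; $\Rightarrow_d:\Pi x:\mathit{Prop}.(\mathit{Prf}\,x\to\mathit{Prop})\to\mathit{Prop}$, $\mathit{Prf}(x\Rightarrow_d y)\hookrightarrow\Pi z:\mathit{Prf}\,x.\mathit{Prf}(y\,z)$; $\pi:\Pi x:\mathit{Prop}.(\mathit{Prf}\,x\to\mathit{Set})\to\mathit{Set}$, $\mathit{El}(\pi\,x\,y)\hookrightarrow\Pi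 z:\mathit{Prf}\,x.\mathit{El}(y\,z)$; $0:I$; $\mathit{succ}:I\to I$; $\mathit{pred}:I\to I$, $\mathit{pred}\,0\hookrightarrow0$, $\mathit{pred}(\mathit{succ}\,x)\hookrightarrow x$; $\mathit{positive}:I\to\mathit{Prop}$, $\mathit{positive}\,0\hookrightarrow\bot$, $\mathit{positive}(\mathit{succ}\,x)\hookrightarrow\top$; $\mathit{psub}:\Pi t:\mathit{Set}.(\mathit{El}\,t\to\mathit{Prop})\to\mathit{Set}$; $\mathit{pair}:\Pi t:\mathit{Set}.\Pi p:(\mathit{El}\,t\to\mathit{Prop}).\Pi m:\mathit{El}\,t.\mathit{Prf}(p\,m)\to\mathit{El}(\mathit{psub}\,t\,p)$; $\mathit{pair}^\dagger:\Pi t:\mathit{Set}.\Pi p:(\mathit{El}\,t\to\mathit{Prop}).\mathit{El}\,t\to\mathit{El}(\mathit{psub}\,t\,p)$, $\mathit{pair}\,t\,p\,m\,h\hookrightarrow\mathit{pair}^\dagger\,t\,p\,m$; $\mathit{fst}:\Pi t:\mathit{Set}.\Pi p:(\mathit{El}\,t\to\mathit{Prop}).\mathit{El}(\mathit{psub}\,t\,p)\to\mathit{El}\,t$, $\mathit{fst}\,t\,p\,(\mathit{pair}^\dagger\,t'\,p'\,m)\hookrightarrow m$; $\mathit{snd}:\Pi t:\mathit{Set}.\Pi p:(\mathit{El}\,t\to\mathit{Prop}).\Pi m:\mathit{El}(\mathit{psub}\,t\,p).\mathit{Prf}(p(\mathit{fst}\,t\,p\,m))$; $\mathit{Set1}:\mathtt{TYPE}$;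 $\mathit{set}:\mathit{Set1}$; $\rightsquigarrow_d:\Pi x:\mathit{Set}.(\mathit{El}\,x\to\mathit{Set1})\to\mathit{Set1}$; $\mathit{Ty}:\mathit{Set1}\to\mathtt{TYPE}$, $\mathit{Ty}\,\mathit{set}\hookrightarrow\mathit{Set}$, $\mathit{Ty}(x\rightsquigarrow_d y)\hookrightarrow\Pi z:\mathit{El}\,x.\mathit{Ty}(y\,z)$; $\mathit{Scheme}:\mathtt{TYPE}$; $\mathit{Els}:\mathit{Scheme}\to\mathtt{TYPE}$; $\uparrow:\mathit{Set}\to\mathit{Scheme}$, $\mathit{Els}(\uparrow x)\hookrightarrow\mathit{El}\,x$; $\mathsf{A}:(\mathit{Set}\to\mathit{Scheme})\to\mathit{Scheme}$, $\mathit{Els}(\mathsf{A}\,p)\hookrightarrow\Pi x:\mathit{Set}.\mathit{Els}(p\,x)$; $\mathcal{A}:(\mathit{Set}\to\mathit{Prop})\to\mathit{Prop}$, $\mathit{Prf}(\mathcal{A}\,p)\hookrightarrow\Pi x:\mathit{Set}.\mathit{Prf}(p\,x)$. *)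

theory Defs
  imports Main
begin

section \<open>Terms of the lambda-Pi-calculus modulo theory\<close>

text \<open>Terms are taken up to renaming of bound variables, in de Bruijn notation: \<open>Pi A B\<close> and
  \<open>Lam A t\<close> bind index \<open>0\<close> in their second argument. The set function \<open>constants\<close> of the datatype
  yields the constants occurring in a term.\<close>

datatype (constants: 'c) trm =
    Const 'c
  | Var nat
  | Type
  | Kind
  | Pi "'c trm" "'c trm"
  | Lam "'c trm" "'c trm"
  | App "'c trm" "'c trm"  (infixl "\<cdot>" 100)

primrec fv :: "'c trm \<Rightarrow> nat set" where
  "fv (Const c) = {}"
| "fv (Var n) = {n}"
| "fv Type = {}"
| "fv Kind = {}"
| "fv (Pi A B) = fv A \<union> {n. Suc n \<in> fv B}"
| "fv (Lam A t) = fv A \<union> {n. Suc n \<in> fv t}"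
| "fv (t \<cdot> u) = fv t \<union> fv u"

definition upren :: "(nat \<Rightarrow> nat) \<Rightarrow> nat \<Rightarrow> nat" where
  "upren f n = (case n of 0 \<Rightarrow> 0 | Suc m \<Rightarrow> Suc (f m))"

primrec ren :: "(nat \<Rightarrow> nat) \<Rightarrow> 'c trm \<Rightarrow> 'c trm" where
  "ren f (Const c) = Const c"
| "ren f (Var n) = Var (f n)"
| "ren f Type = Type"
| "ren f Kind = Kind"
| "ren f (Pi A B) = Pi (ren f A) (ren (upren f) B)"
| "ren f (Lam A t) = Lam (ren f A) (ren (upren f) t)"
| "ren f (t \<cdot> u) = ren f t \<cdot> ren f u"

definition lift :: "nat \<Rightarrow> 'c trm \<Rightarrow> 'c trm" where
  "lift k = ren (\<lambda>n. n + k)"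

definition upsubst :: "(nat \<Rightarrow> 'c trm) \<Rightarrow> nat \<Rightarrow> 'c trm" where
  "upsubst \<theta> n = (case n of 0 \<Rightarrow> Var 0 | Suc m \<Rightarrow> lift 1 (\<theta> m))"

primrec subst :: "(nat \<Rightarrow> 'c trm) \<Rightarrow> 'c trm \<Rightarrow> 'c trm" where
  "subst \<theta> (Const c) = Const c"
| "subst \<theta> (Var n) = \<theta> n"
| "subst \<theta> Type = Type"
| "subst \<theta> Kind = Kind"
| "subst \<theta> (Pi A B) = Pi (subst \<theta> A) (subst (upsubst \<theta>) B)"
| "subst \<theta> (Lam A t) = Lam (subst \<theta> A) (subst (upsubst \<theta>) t)"
| "subst \<theta> (t \<cdot> u) = subst \<theta> t \<cdot> subst \<theta> u"

text \<open>\<open>inst u t\<close> is \<open>(u/x)t\<close>, where \<open>x\<close> is index \<open>0\<close> of \<open>t\<close>.\<close>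

definition inst :: "'c trm \<Rightarrow> 'c trm \<Rightarrow> 'c trm" where
  "inst u = subst (\<lambda>n. case n of 0 \<Rightarrow> u | Suc m \<Rightarrow> Var m)"

text \<open>The operands of \<open>A \<rightarrow> B\<close> live in the same scope, so indices in \<open>B\<close> do not count the binder.\<close>

abbreviation arr :: "'c trm \<Rightarrow> 'c trm \<Rightarrow> 'c trm"  (infixr "\<rightarrow>" 60) where
  "A \<rightarrow> B \<equiv> Pi A (lift 1 B)"


section \<open>Rewriting\<close>

text \<open>The free variables of a rule are its pattern variables.\<close>

type_synonym 'c rule = "'c trm \<times> 'c trm"

inductive cong :: "('c trm \<Rightarrow> 'c trm \<Rightarrow> bool) \<Rightarrow> 'c trm \<Rightarrow> 'c trm \<Rightarrow> bool"
  for P :: "'c trm \<Rightarrow> 'c trm \<Rightarrow> bool" where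
  root: "P t u \<Longrightarrow> cong P t u"
| Pi_dom: "cong P A A' \<Longrightarrow> cong P (Pi A B) (Pi A' B)"
| Pi_cod: "cong P B B' \<Longrightarrow> cong P (Pi A B) (Pi A B')"
| Lam_dom: "cong P A A' \<Longrightarrow> cong P (Lam A t) (Lam A' t)"
| Lam_body: "cong P t t' \<Longrightarrow> cong P (Lam A t) (Lam A t')"
| App_fun: "cong P t t' \<Longrightarrow> cong P (t \<cdot> u) (t' \<cdot> u)"
| App_arg: "cong P u u' \<Longrightarrow> cong P (t \<cdot> u) (t \<cdot> u')"

inductive beta_root :: "'c trm \<Rightarrow> 'c trm \<Rightarrow> bool" where
  "beta_root (Lam A t \<cdot> u) (inst u t)"

inductive rule_root :: "'c rule set \<Rightarrow> 'c trm \<Rightarrow> 'c trm \<Rightarrow> bool" for R :: "'c rule set" where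
  "(l, r) \<in> R \<Longrightarrow> rule_root R (subst \<theta> l) (subst \<theta> r)"

definition step :: "'c rule set \<Rightarrow> 'c trm \<Rightarrow> 'c trm \<Rightarrow> bool" where
  "step R t u \<longleftrightarrow> cong beta_root t u \<or> cong (rule_root R) t u"

abbreviation convertible :: "'c rule set \<Rightarrow> 'c trm \<Rightarrow> 'c trm \<Rightarrow> bool" where
  "convertible R \<equiv> equivclp (step R)"

definition confluent_on :: "'a set \<Rightarrow> ('a \<Rightarrow> 'a \<Rightarrow> bool) \<Rightarrow> bool" where
  "confluent_on X r \<longleftrightarrow>
    (\<forall>t\<in>X. \<forall>u v. r\<^sup>*\<^sup>* t u \<longrightarrow> r\<^sup>*\<^sup>* t v \<longrightarrow> (\<exists>w. r\<^sup>*\<^sup>* u w \<and> r\<^sup>*\<^sup>* v w))"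


section \<open>Typing\<close>

type_synonym 'c signature = "('c \<times> 'c trm) list"

definition declared :: "'c signature \<Rightarrow> 'c set" where
  "declared S = fst ` set S"

definition Lambda :: "'c signature \<Rightarrow> 'c trm set" where
  "Lambda S = {t. constants t \<subseteq> declared S}"

text \<open>Contexts are lists of types with the most recent declaration first; each type lives in the
  scope of the declarations after it in the list. Types in signatures are closed, so the rule
  \<open>const\<close> needs no lifting.\<close>

inductive wf_ctx :: "'c signature \<Rightarrow> 'c rule set \<Rightarrow> 'c trm list \<Rightarrow> bool"
  and has_type :: "'c signature \<Rightarrow> 'c rule set \<Rightarrow> 'c trm list \<Rightarrow> 'c trm \<Rightarrow> 'c trm \<Rightarrow> bool"
  for S :: "'c signature" and R :: "'c rule set" where
  empty: "wf_ctx S R []"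
| decl: "has_type S R \<Gamma> A s \<Longrightarrow> s \<in> {Type, Kind} \<Longrightarrow> wf_ctx S R (A # \<Gamma>)"
| sort: "wf_ctx S R \<Gamma> \<Longrightarrow> has_type S R \<Gamma> Type Kind"
| const: "wf_ctx S R \<Gamma> \<Longrightarrow> has_type S R [] A s \<Longrightarrow> s \<in> {Type, Kind} \<Longrightarrow> (c, A) \<in> set S \<Longrightarrow>
    has_type S R \<Gamma> (Const c) A"
| var: "wf_ctx S R \<Gamma> \<Longrightarrow> i < length \<Gamma> \<Longrightarrow> has_type S R \<Gamma> (Var i) (lift (Suc i) (\<Gamma> ! i))"
| prod: "has_type S R \<Gamma> A Type \<Longrightarrow> has_type S R (A # \<Gamma>) B s \<Longrightarrow> s \<in> {Type, Kind} \<Longrightarrow>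
    has_type S R \<Gamma> (Pi A B) s"
| abs: "has_type S R \<Gamma> A Type \<Longrightarrow> has_type S R (A # \<Gamma>) B s \<Longrightarrow> s \<in> {Type, Kind} \<Longrightarrow>
    has_type S R (A # \<Gamma>) t B \<Longrightarrow> has_type S R \<Gamma> (Lam A t) (Pi A B)"
| app: "has_type S R \<Gamma> t (Pi A B) \<Longrightarrow> has_type S R \<Gamma> u A \<Longrightarrow> has_type S R \<Gamma> (t \<cdot> u) (inst u B)"
| conv: "has_type S R \<Gamma> t A \<Longrightarrow> has_type S R \<Gamma> B s \<Longrightarrow> s \<in> {Type, Kind} \<Longrightarrow> convertible R A B \<Longrightarrow>
    has_type S R \<Gamma> t B"


section \<open>Systems, theories and fragments\<close>

definition is_system :: "'c signature \<Rightarrow> 'c rule set \<Rightarrow> bool" where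
  "is_system S R \<longleftrightarrow>
    (\<forall>(c, A)\<in>set S. fv A = {}) \<and>
    (\<forall>(l, r)\<in>R. (\<exists>c ts. l = foldl App (Const c) ts) \<and> l \<in> Lambda S \<and> r \<in> Lambda S)"

definition preserves_typing :: "'c signature \<Rightarrow> 'c rule set \<Rightarrow> 'c rule \<Rightarrow> bool" where
  "preserves_typing S R \<rho> \<longleftrightarrow>
    (\<forall>\<Gamma> \<theta> A. set \<Gamma> \<subseteq> Lambda S \<longrightarrow> range \<theta> \<subseteq> Lambda S \<longrightarrow> A \<in> Lambda S \<longrightarrow>
      has_type S R \<Gamma> (subst \<theta> (fst \<rho>)) A \<longrightarrow> has_type S R \<Gamma> (subst \<theta> (snd \<rho>)) A)"

definition is_theory :: "'c signature \<Rightarrow> 'c rule set \<Rightarrow> bool" where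
  "is_theory S R \<longleftrightarrow>
    is_system S R \<and> confluent_on (Lambda S) (step R) \<and> (\<forall>\<rho>\<in>R. preserves_typing S R \<rho>)"

text \<open>A fragment is in particular a system, just as a theory is.\<close>

definition is_fragment ::
  "'c signature \<Rightarrow> 'c rule set \<Rightarrow> 'c signature \<Rightarrow> 'c rule set \<Rightarrow> bool" where
  "is_fragment S1 R1 S0 R0 \<longleftrightarrow>
    is_system S1 R1 \<and>
    set S1 \<subseteq> set S0 \<and> R1 \<subseteq> R0 \<and>
    (\<forall>(c, A)\<in>set S1. constants A \<subseteq> declared S1) \<and>
    (\<forall>(l, r)\<in>R0. constants l \<subseteq> declared S1 \<longrightarrow>
      constants r \<subseteq> declared S1 \<and> (l, r) \<in> R1)"


section \<open>The system U\<close>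

text \<open>The suffix \<open>c\<close> marks the classical variants of connectives. \<open>C_leadsto\<close>, \<open>C_leadstod\<close> form
  simple and dependent function types in \<open>Set\<close>, \<open>C_leadstod1\<close> is the dependent arrow into
  \<open>Set1\<close>, \<open>C_pairdag\<close> is the proof-irrelevant pair, and \<open>C_allSch\<close>, \<open>C_allSet\<close> are the
  quantifiers over \<open>Set\<close> into \<open>Scheme\<close> and \<open>Prop\<close>.\<close>

datatype ucon =
    C_I | C_Set | C_El | C_iota | C_Prop | C_Prf
  | C_imp | C_all | C_top | C_bot | C_not | C_and | C_or | C_ex
  | C_Prfc | C_impc | C_andc | C_orc | C_allc | C_exc
  | C_o | C_leadsto | C_leadstod | C_impd | C_pi
  | C_zero | C_succ | C_pred | C_positive
  | C_psub | C_pair | C_pairdag | C_fst | C_snd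
  | C_Set1 | C_set | C_leadstod1 | C_Ty
  | C_Scheme | C_Els | C_up | C_allSch | C_allSet

type_synonym utrm = "ucon trm"

abbreviation I :: utrm where "I \<equiv> Const C_I"
abbreviation USet :: utrm where "USet \<equiv> Const C_Set"
abbreviation UProp :: utrm where "UProp \<equiv> Const C_Prop"
abbreviation Set1 :: utrm where "Set1 \<equiv> Const C_Set1"
abbreviation Scheme :: utrm where "Scheme \<equiv> Const C_Scheme"
abbreviation El :: "utrm \<Rightarrow> utrm" where "El a \<equiv> Const C_El \<cdot> a"
abbreviation Prf :: "utrm \<Rightarrow> utrm" where "Prf x \<equiv> Const C_Prf \<cdot> x"
abbreviation Ty :: "utrm \<Rightarrow> utrm" where "Ty a \<equiv> Const C_Ty \<cdot> a"
abbreviation Els :: "utrm \<Rightarrow> utrm" where "Els a \<equiv> Const C_Els \<cdot> a"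
abbreviation NotNot :: "utrm \<Rightarrow> utrm" where "NotNot x \<equiv> Const C_not \<cdot> (Const C_not \<cdot> x)"
abbreviation psub :: "utrm \<Rightarrow> utrm \<Rightarrow> utrm" where "psub t p \<equiv> Const C_psub \<cdot> t \<cdot> p"

definition Sig_U :: "ucon signature" where
  "Sig_U = [
    (C_I, Type),
    (C_Set, Type),
    (C_El, USet \<rightarrow> Type),
    (C_iota, USet),
    (C_Prop, Type),
    (C_Prf, UProp \<rightarrow> Type),
    (C_imp, UProp \<rightarrow> UProp \<rightarrow> UProp),
    (C_all, Pi USet ((El (Var 0) \<rightarrow> UProp) \<rightarrow> UProp)),
    (C_top, UProp),
    (C_bot, UProp),
    (C_not, UProp \<rightarrow> UProp),
    (C_and, UProp \<rightarrow> UProp \<rightarrow> UProp),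
    (C_or, UProp \<rightarrow> UProp \<rightarrow> UProp),
    (C_ex, Pi USet ((El (Var 0) \<rightarrow> UProp) \<rightarrow> UProp)),
    (C_Prfc, UProp \<rightarrow> Type),
    (C_impc, UProp \<rightarrow> UProp \<rightarrow> UProp),
    (C_andc, UProp \<rightarrow> UProp \<rightarrow> UProp),
    (C_orc, UProp \<rightarrow> UProp \<rightarrow> UProp),
    (C_allc, Pi USet ((El (Var 0) \<rightarrow> UProp) \<rightarrow> UProp)),
    (C_exc, Pi USet ((El (Var 0) \<rightarrow> UProp) \<rightarrow> UProp)),
    (C_o, USet),
    (C_leadsto, USet \<rightarrow> USet \<rightarrow> USet),
    (C_leadstod, Pi USet ((El (Var 0) \<rightarrow> USet) \<rightarrow> USet)),
    (C_impd, Pi UProp ((Prf (Var 0) \<rightarrow> UProp) \<rightarrow> UProp)),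
    (C_pi, Pi UProp ((Prf (Var 0) \<rightarrow> USet) \<rightarrow> USet)),
    (C_zero, I),
    (C_succ, I \<rightarrow> I),
    (C_pred, I \<rightarrow> I),
    (C_positive, I \<rightarrow> UProp),
    (C_psub, Pi USet ((El (Var 0) \<rightarrow> UProp) \<rightarrow> USet)),
    (C_pair, Pi USet (Pi (El (Var 0) \<rightarrow> UProp) (Pi (El (Var 1))
      (Prf (Var 1 \<cdot> Var 0) \<rightarrow> El (psub (Var 2) (Var 1)))))),
    (C_pairdag, Pi USet (Pi (El (Var 0) \<rightarrow> UProp)
      (El (Var 1) \<rightarrow> El (psub (Var 1) (Var 0))))),
    (C_fst, Pi USet (Pi (El (Var 0) \<rightarrow> UProp)
      (El (psub (Var 1) (Var 0)) \<rightarrow> El (Var 1)))),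
    (C_snd, Pi USet (Pi (El (Var 0) \<rightarrow> UProp) (Pi (El (psub (Var 1) (Var 0)))
      (Prf (Var 1 \<cdot> (Const C_fst \<cdot> Var 2 \<cdot> Var 1 \<cdot> Var 0)))))),
    (C_Set1, Type),
    (C_set, Set1),
    (C_leadstod1, Pi USet ((El (Var 0) \<rightarrow> Set1) \<rightarrow> Set1)),
    (C_Ty, Set1 \<rightarrow> Type),
    (C_Scheme, Type),
    (C_Els, Scheme \<rightarrow> Type),
    (C_up, USet \<rightarrow> Scheme),
    (C_allSch, (USet \<rightarrow> Scheme) \<rightarrow> Scheme),
    (C_allSet, (USet \<rightarrow> UProp) \<rightarrow> UProp)]"

text \<open>Pattern variables are numbered from \<open>0\<close> in the order in which they occur in the left-hand
  side.\<close>

definition Rules_U :: "ucon rule set" where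
  "Rules_U = {
    (El (Const C_iota), I),
    (Prf (Const C_imp \<cdot> Var 0 \<cdot> Var 1), Prf (Var 0) \<rightarrow> Prf (Var 1)),
    (Prf (Const C_all \<cdot> Var 0 \<cdot> Var 1), Pi (El (Var 0)) (Prf (Var 2 \<cdot> Var 0))),
    (Prf (Const C_top), Pi UProp (Prf (Var 0) \<rightarrow> Prf (Var 0))),
    (Prf (Const C_bot), Pi UProp (Prf (Var 0))),
    (Prf (Const C_not \<cdot> Var 0), Prf (Var 0) \<rightarrow> Pi UProp (Prf (Var 0))),
    (Prf (Const C_and \<cdot> Var 0 \<cdot> Var 1),
      Pi UProp ((Prf (Var 1) \<rightarrow> Prf (Var 2) \<rightarrow> Prf (Var 0)) \<rightarrow> Prf (Var 0))),
    (Prf (Const C_or \<cdot> Var 0 \<cdot> Var 1),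
      Pi UProp ((Prf (Var 1) \<rightarrow> Prf (Var 0)) \<rightarrow> (Prf (Var 2) \<rightarrow> Prf (Var 0)) \<rightarrow> Prf (Var 0))),
    (Prf (Const C_ex \<cdot> Var 0 \<cdot> Var 1),
      Pi UProp (Pi (El (Var 1)) (Prf (Var 3 \<cdot> Var 0) \<rightarrow> Prf (Var 1)) \<rightarrow> Prf (Var 0))),
    (Const C_Prfc, Lam UProp (Prf (NotNot (Var 0)))),
    (Const C_impc,
      Lam UProp (Lam UProp (Const C_imp \<cdot> NotNot (Var 1) \<cdot> NotNot (Var 0)))),
    (Const C_andc,
      Lam UProp (Lam UProp (Const C_and \<cdot> NotNot (Var 1) \<cdot> NotNot (Var 0)))),
    (Const C_orc,
      Lam UProp (Lam UProp (Const C_or \<cdot> NotNot (Var 1) \<cdot> NotNot (Var 0)))),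
    (Const C_allc, Lam USet (Lam (El (Var 0) \<rightarrow> UProp)
      (Const C_all \<cdot> Var 1 \<cdot> Lam (El (Var 1)) (NotNot (Var 1 \<cdot> Var 0))))),
    (Const C_exc, Lam USet (Lam (El (Var 0) \<rightarrow> UProp)
      (Const C_ex \<cdot> Var 1 \<cdot> Lam (El (Var 1)) (NotNot (Var 1 \<cdot> Var 0))))),
    (El (Const C_o), UProp),
    (El (Const C_leadsto \<cdot> Var 0 \<cdot> Var 1), El (Var 0) \<rightarrow> El (Var 1)),
    (El (Const C_leadstod \<cdot> Var 0 \<cdot> Var 1), Pi (El (Var 0)) (El (Var 2 \<cdot> Var 0))),
    (Prf (Const C_impd \<cdot> Var 0 \<cdot> Var 1), Pi (Prf (Var 0)) (Prf (Var 2 \<cdot> Var 0))),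
    (El (Const C_pi \<cdot> Var 0 \<cdot> Var 1), Pi (Prf (Var 0)) (El (Var 2 \<cdot> Var 0))),
    (Const C_pred \<cdot> Const C_zero, Const C_zero),
    (Const C_pred \<cdot> (Const C_succ \<cdot> Var 0), Var 0),
    (Const C_positive \<cdot> Const C_zero, Const C_bot),
    (Const C_positive \<cdot> (Const C_succ \<cdot> Var 0), Const C_top),
    (Const C_pair \<cdot> Var 0 \<cdot> Var 1 \<cdot> Var 2 \<cdot> Var 3, Const C_pairdag \<cdot> Var 0 \<cdot> Var 1 \<cdot> Var 2),
    (Const C_fst \<cdot> Var 0 \<cdot> Var 1 \<cdot> (Const C_pairdag \<cdot> Var 2 \<cdot> Var 3 \<cdot> Var 4), Var 4),
    (Ty (Const C_set), USet),
    (Ty (Const C_leadstod1 \<cdot> Var 0 \<cdot> Var 1), Pi (El (Var 0)) (Ty (Var 2 \<cdot> Var 0))),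
    (Els (Const C_up \<cdot> Var 0), El (Var 0)),
    (Els (Const C_allSch \<cdot> Var 0), Pi USet (Els (Var 1 \<cdot> Var 0))),
    (Prf (Const C_allSet \<cdot> Var 0), Pi USet (Prf (Var 1 \<cdot> Var 0)))}"

end

theory Submission
  imports Defs "HOL-Library.Confluence"
begin

text \<open>
  The rules are left-linear and overlap neither each other nor beta, so parallel reduction has the
  diamond property; as this only depends on non-overlap, it is inherited by every subset of the
  rules. Confluence makes products injective up to conversion, so a typing of an instance
  \<open>\<theta> l\<close> of a left-hand side forces the types of the \<open>\<theta> i\<close> and, up to conversion, the type of
  \<open>\<theta> l\<close>. For all rules but one, the right-hand side has that very type by a derivation without
  conversion, found by a syntax-directed inference algorithm; such a derivation only mentions
  constants that every fragment containing the rule declares. The exception is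
  \<open>fst t p (pair\<dagger> t' p' m) \<hookrightarrow> m\<close>, where the two occurrences of \<open>El (psub _ _)\<close> have to be
  compared: no rule applies at \<open>psub\<close> or above it, so \<open>t\<close> and \<open>t'\<close> are convertible.
\<close>

subsection \<open>Renaming and substitution\<close>

lemma lift_1: "lift (Suc 0) = ren Suc"
  by (simp add: lift_def)

lemma upren_simps [simp]: "upren f 0 = 0" "upren f (Suc n) = Suc (f n)"
  by (simp_all add: upren_def)

lemma upsubst_simps [simp]: "upsubst \<theta> 0 = Var 0" "upsubst \<theta> (Suc n) = ren Suc (\<theta> n)"
  by (simp_all add: upsubst_def lift_1)

lemma upren_comp: "upren f \<circ> upren g = upren (f \<circ> g)"
proof
  show "(upren f \<circ> upren g) n = upren (f \<circ> g) n" for n by (cases n) simp_all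
qed

lemma ren_ren: "ren f (ren g t) = ren (f \<circ> g) t"
  by (induction t arbitrary: f g) (simp_all add: upren_comp)

lemma upsubst_upren: "upsubst \<theta> \<circ> upren f = upsubst (\<theta> \<circ> f)"
proof
  show "(upsubst \<theta> \<circ> upren f) n = upsubst (\<theta> \<circ> f) n" for n by (cases n) simp_all
qed

lemma subst_ren: "subst \<theta> (ren f t) = subst (\<theta> \<circ> f) t"
  by (induction t arbitrary: \<theta> f) (simp_all add: upsubst_upren)

lemma ren_upren_Suc: "ren (upren f) (ren Suc t) = ren Suc (ren f t)"
  by (simp add: ren_ren comp_def)

lemma ren_upsubst: "ren (upren f) \<circ> upsubst \<theta> = upsubst (ren f \<circ> \<theta>)"
proof
  show "(ren (upren f) \<circ> upsubst \<theta>) n = upsubst (ren f \<circ> \<theta>) n" for n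
    by (cases n) (simp_all add: ren_upren_Suc)
qed

lemma ren_subst: "ren f (subst \<theta> t) = subst (ren f \<circ> \<theta>) t"
  by (induction t arbitrary: \<theta> f) (simp_all add: ren_upsubst)

lemma lift_Suc: "lift (Suc n) t = ren Suc (lift n t)"
  by (simp add: lift_def ren_ren comp_def)

lemma subst_upsubst_Suc: "subst (upsubst \<theta>) (ren Suc t) = ren Suc (subst \<theta> t)"
  by (simp add: subst_ren ren_subst comp_def)

lemma subst_upsubst: "subst (upsubst \<sigma>) \<circ> upsubst \<theta> = upsubst (subst \<sigma> \<circ> \<theta>)"
proof
  show "(subst (upsubst \<sigma>) \<circ> upsubst \<theta>) n = upsubst (subst \<sigma> \<circ> \<theta>) n" for n
    by (cases n) (simp_all add: subst_upsubst_Suc)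
qed

lemma subst_subst: "subst \<sigma> (subst \<theta> t) = subst (subst \<sigma> \<circ> \<theta>) t"
  by (induction t arbitrary: \<sigma> \<theta>) (simp_all add: subst_upsubst)

lemma upsubst_Var: "upsubst (Var \<circ> f) = Var \<circ> upren f"
proof
  show "upsubst (Var \<circ> f) n = (Var \<circ> upren f) n" for n by (cases n) simp_all
qed

lemma ren_eq_subst: "ren f t = subst (Var \<circ> f) t"
  by (induction t arbitrary: f) (simp_all add: upsubst_Var)

lemma ren_id [simp]: "ren (\<lambda>n. n) t = t"
proof -
  have up: "upren (\<lambda>n. n) = (\<lambda>n. n)"
  proof
    show "upren (\<lambda>n. n) n = n" for n by (cases n) simp_all
  qed
  show ?thesis by (induction t) (simp_all add: up)
qed

lemma subst_Var [simp]: "subst Var t = t"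
  using ren_eq_subst [of "\<lambda>n. n" t] by (simp add: comp_def)

lemma subst_cong_fv: "(\<And>i. i \<in> fv t \<Longrightarrow> \<theta> i = \<sigma> i) \<Longrightarrow> subst \<theta> t = subst \<sigma> t"
proof (induction t arbitrary: \<theta> \<sigma>)
  case (Pi A B)
  have "subst (upsubst \<theta>) B = subst (upsubst \<sigma>) B"
  proof (rule Pi.IH(2))
    show "upsubst \<theta> i = upsubst \<sigma> i" if "i \<in> fv B" for i
      using that Pi.prems by (cases i) simp_all
  qed
  moreover have "subst \<theta> A = subst \<sigma> A" using Pi.prems by (intro Pi.IH(1)) simp
  ultimately show ?case by simp
next
  case (Lam A B)
  have "subst (upsubst \<theta>) B = subst (upsubst \<sigma>) B"
  proof (rule Lam.IH(2))
    show "upsubst \<theta> i = upsubst \<sigma> i" if "i \<in> fv B" for i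
      using that Lam.prems by (cases i) simp_all
  qed
  moreover have "subst \<theta> A = subst \<sigma> A" using Lam.prems by (intro Lam.IH(1)) simp
  ultimately show ?case by simp
next
  case (App t u)
  have "subst \<theta> t = subst \<sigma> t" "subst \<theta> u = subst \<sigma> u"
    using App.prems by (auto intro!: App.IH)
  then show ?case by simp
qed simp_all

lemma subst_closed: "fv t = {} \<Longrightarrow> subst \<theta> t = t"
  using subst_cong_fv [of t \<theta> Var] by simp

lemma ren_closed: "fv t = {} \<Longrightarrow> ren f t = t"
  by (simp add: ren_eq_subst subst_closed)

lemma inst_eq: "inst u = subst (case_nat u Var)"
  by (simp add: inst_def)

lemma subst_inst: "subst \<theta> (inst u t) = inst (subst \<theta> u) (subst (upsubst \<theta>) t)"
proof -
  have "(subst \<theta> \<circ> case_nat u Var) n = (subst (case_nat (subst \<theta> u) Var) \<circ> upsubst \<theta>) n" for n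
    by (cases n) (simp_all add: subst_ren comp_def)
  then show ?thesis unfolding inst_eq subst_subst by presburger
qed

lemma ren_inst: "ren f (inst u t) = inst (ren f u) (ren (upren f) t)"
  by (simp add: ren_eq_subst subst_inst upsubst_Var)

lemma subst_eq_Kind: "subst \<theta> t = Kind \<longleftrightarrow> t = Kind \<or> (\<exists>i. t = Var i \<and> \<theta> i = Kind)"
  by (cases t) simp_all

lemma inst_ren_Suc [simp]: "inst u (ren Suc t) = t"
  by (simp add: inst_eq subst_ren comp_def)


subsection \<open>Reduction\<close>

text \<open>One closure of the union allows a single induction for both kinds of root step.\<close>

lemma step_eq: "step R = cong (\<lambda>t u. beta_root t u \<or> rule_root R t u)"
proof (intro ext iffI)
  fix t u
  show "cong (\<lambda>t u. beta_root t u \<or> rule_root R t u) t u" if "step R t u"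
  proof -
    have "cong beta_root t u \<Longrightarrow> ?thesis" by (induction rule: cong.induct) (auto intro: cong.intros)
    moreover have "cong (rule_root R) t u \<Longrightarrow> ?thesis"
      by (induction rule: cong.induct) (auto intro: cong.intros)
    ultimately show ?thesis using that by (auto simp: step_def)
  qed
  show "step R t u" if "cong (\<lambda>t u. beta_root t u \<or> rule_root R t u) t u"
    using that by (induction rule: cong.induct) (auto simp: step_def intro: cong.intros)
qed

lemma beta_stepI: "step R (Lam A t \<cdot> u) (inst u t)"
  by (simp add: step_eq beta_root.intros cong.root)

lemma rule_stepI: "(l, r) \<in> R \<Longrightarrow> step R (subst \<theta> l) (subst \<theta> r)"
  by (simp add: step_eq rule_root.intros cong.root)

lemma step_congs:
  "step R A A' \<Longrightarrow> step R (Pi A B) (Pi A' B)"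
  "step R B B' \<Longrightarrow> step R (Pi A B) (Pi A B')"
  "step R A A' \<Longrightarrow> step R (Lam A t) (Lam A' t)"
  "step R t t' \<Longrightarrow> step R (Lam A t) (Lam A t')"
  "step R t t' \<Longrightarrow> step R (t \<cdot> u) (t' \<cdot> u)"
  "step R u u' \<Longrightarrow> step R (t \<cdot> u) (t \<cdot> u')"
  by (simp_all add: step_eq cong.intros)

lemma step_subst: "step R t u \<Longrightarrow> step R (subst \<theta> t) (subst \<theta> u)"
  unfolding step_eq
proof (induction arbitrary: \<theta> rule: cong.induct)
  case (root t u)
  then show ?case
  proof
    assume "beta_root t u"
    then show ?thesis
      by cases (auto simp: subst_inst intro!: cong.root beta_root.intros)
  next
    assume "rule_root R t u"
    then show ?thesis
      by cases (auto simp: subst_subst intro!: cong.root rule_root.intros)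
  qed
qed (auto intro: cong.intros)

lemma rtranclp_map:
  assumes "r\<^sup>*\<^sup>* x y" and "\<And>x y. r x y \<Longrightarrow> r (f x) (f y)"
  shows "r\<^sup>*\<^sup>* (f x) (f y)"
  using assms(1) by induction (auto intro: assms(2) rtranclp.rtrancl_into_rtrancl)

lemma equivclp_map:
  assumes "equivclp r x y" and "\<And>x y. r x y \<Longrightarrow> r (f x) (f y)"
  shows "equivclp r (f x) (f y)"
  using assms(1)
proof induction
  case (step y z)
  then show ?case by (meson assms(2) equivclp_into_equivclp)
qed simp

lemma convertible_subst: "convertible R t u \<Longrightarrow> convertible R (subst \<theta> t) (subst \<theta> u)"
  by (erule equivclp_map) (rule step_subst)

lemma convertible_ren: "convertible R t u \<Longrightarrow> convertible R (ren f t) (ren f u)"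
  by (simp add: ren_eq_subst convertible_subst)

lemma convertible_inst: "convertible R t t' \<Longrightarrow> convertible R (inst u t) (inst u t')"
  by (simp add: inst_eq convertible_subst)

lemma convertible_App_arg: "convertible R u u' \<Longrightarrow> convertible R (t \<cdot> u) (t \<cdot> u')"
  by (erule equivclp_map) (rule step_congs(6))

lemma convertible_if_joinable:
  assumes "(step R)\<^sup>*\<^sup>* t w" and "(step R)\<^sup>*\<^sup>* u w"
  shows "convertible R t u"
proof -
  have "((step R)\<^sup>*\<^sup>* OO (step R)\<inverse>\<inverse>\<^sup>*\<^sup>*) t u" using assms by (auto simp: rtranclp_conversep)
  then show ?thesis by (rule predicate2D [OF r_OO_conversep_into_equivclp])
qed

lemma steps_congs:
  assumes A: "(step R)\<^sup>*\<^sup>* A A'" and B: "(step R)\<^sup>*\<^sup>* B B'"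
  shows "(step R)\<^sup>*\<^sup>* (Pi A B) (Pi A' B')"
    and "(step R)\<^sup>*\<^sup>* (Lam A B) (Lam A' B')"
    and "(step R)\<^sup>*\<^sup>* (A \<cdot> B) (A' \<cdot> B')"
proof -
  have "(step R)\<^sup>*\<^sup>* (Pi A B) (Pi A' B)"
    by (rule rtranclp_map [OF A, where f = "\<lambda>x. Pi x B"]) (rule step_congs)
  also have "(step R)\<^sup>*\<^sup>* (Pi A' B) (Pi A' B')"
    by (rule rtranclp_map [OF B]) (rule step_congs)
  finally show "(step R)\<^sup>*\<^sup>* (Pi A B) (Pi A' B')" .
  have "(step R)\<^sup>*\<^sup>* (Lam A B) (Lam A' B)"
    by (rule rtranclp_map [OF A, where f = "\<lambda>x. Lam x B"]) (rule step_congs)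
  also have "(step R)\<^sup>*\<^sup>* (Lam A' B) (Lam A' B')"
    by (rule rtranclp_map [OF B]) (rule step_congs)
  finally show "(step R)\<^sup>*\<^sup>* (Lam A B) (Lam A' B')" .
  have "(step R)\<^sup>*\<^sup>* (A \<cdot> B) (A' \<cdot> B)"
    by (rule rtranclp_map [OF A, where f = "\<lambda>x. x \<cdot> B"]) (rule step_congs)
  also have "(step R)\<^sup>*\<^sup>* (A' \<cdot> B) (A' \<cdot> B')"
    by (rule rtranclp_map [OF B]) (rule step_congs)
  finally show "(step R)\<^sup>*\<^sup>* (A \<cdot> B) (A' \<cdot> B')" .
qed


subsection \<open>Confluence of orthogonal rules together with beta\<close>

text \<open>Disjointness of \<open>fv f\<close> and \<open>fv a\<close> is linearity. Variables
  occur only as arguments, so the head is always a constant.\<close>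

primrec pattern :: "'c trm \<Rightarrow> bool" where
  "pattern (Const c) \<longleftrightarrow> True"
| "pattern (Var i) \<longleftrightarrow> False"
| "pattern Type \<longleftrightarrow> False"
| "pattern Kind \<longleftrightarrow> False"
| "pattern (Pi A B) \<longleftrightarrow> False"
| "pattern (Lam A t) \<longleftrightarrow> False"
| "pattern (f \<cdot> a) \<longleftrightarrow>
    pattern f \<and> (case a of Var i \<Rightarrow> True | _ \<Rightarrow> pattern a) \<and> fv f \<inter> fv a = {}"

lemma pattern_App:
  "pattern (f \<cdot> a) \<longleftrightarrow> pattern f \<and> ((\<exists>i. a = Var i) \<or> pattern a) \<and> fv f \<inter> fv a = {}"
  by (cases a) auto

declare pattern.simps(7) [simp del]

lemma pattern_cases:
  assumes "pattern l"
  obtains c where "l = Const c" | f a where "l = f \<cdot> a"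
  using assms by (cases l) auto

lemma pattern_spine: "pattern l \<Longrightarrow> \<exists>c ts. l = foldl App (Const c) ts"
proof (induction l)
  case (Const c)
  have "Const c = foldl App (Const c) []" by simp
  then show ?case by blast
next
  case (App f a)
  then obtain c ts where "f = foldl App (Const c) ts" by (auto simp: pattern_App)
  then have "f \<cdot> a = foldl App (Const c) (ts @ [a])" by simp
  then show ?case by blast
qed simp_all

text \<open>Partial applications along the spine are included, since a left-hand side such as
  \<open>Const C_Prfc\<close> may match in function position.\<close>

primrec subpatterns :: "'c trm \<Rightarrow> 'c trm set" where
  "subpatterns (Const c) = {}"
| "subpatterns (Var i) = {}"
| "subpatterns Type = {}"
| "subpatterns Kind = {}"
| "subpatterns (Pi A B) = {}"
| "subpatterns (Lam A t) = {}"
| "subpatterns (f \<cdot> a) = insert f (subpatterns f) \<union>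
    (case a of Var i \<Rightarrow> {} | _ \<Rightarrow> insert a (subpatterns a))"

text \<open>A sufficient condition for two patterns to have no common instance.\<close>

fun clash :: "'c trm \<Rightarrow> 'c trm \<Rightarrow> bool" where
  "clash (Const c) (Const d) \<longleftrightarrow> c \<noteq> d"
| "clash (Const c) (g \<cdot> b) \<longleftrightarrow> True"
| "clash (f \<cdot> a) (Const d) \<longleftrightarrow> True"
| "clash (f \<cdot> a) (g \<cdot> b) \<longleftrightarrow> clash f g \<or> clash a b"
| "clash _ _ \<longleftrightarrow> False"

lemma clash_not_unifiable: "clash p q \<Longrightarrow> subst \<theta> p \<noteq> subst \<sigma> q"
  by (induction p q rule: clash.induct) auto

text \<open>No left-hand side overlaps an instance of \<open>q\<close> outside its variables, except possibly at
  the root.\<close>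

definition rigid_below :: "'c rule set \<Rightarrow> 'c trm \<Rightarrow> bool" where
  "rigid_below R q \<longleftrightarrow> (\<forall>q'\<in>subpatterns q. \<forall>(l, r)\<in>R. clash q' l)"

text \<open>With matches at the root excluded too, \<open>q\<close> behaves like a constructor:
  every reduct of an instance of \<open>q\<close> is again an instance of \<open>q\<close>.\<close>

definition rigid :: "'c rule set \<Rightarrow> 'c trm \<Rightarrow> bool" where
  "rigid R q \<longleftrightarrow> pattern q \<and> (\<forall>(l, r)\<in>R. clash q l) \<and> rigid_below R q"

lemma rigid_below_antimono: "rigid_below R q \<Longrightarrow> R' \<subseteq> R \<Longrightarrow> rigid_below R' q"
  by (auto simp: rigid_below_def)

lemma rigid_antimono: "rigid R q \<Longrightarrow> R' \<subseteq> R \<Longrightarrow> rigid R' q"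
  by (auto simp: rigid_def dest: rigid_below_antimono)

text \<open>The immediate components are themselves \<open>subpatterns\<close>, where root matches
  are forbidden. So a left-hand side, rigid only below its root, has fully rigid components.\<close>

lemma rigid_below_App:
  assumes "pattern (f \<cdot> a)" and "rigid_below R (f \<cdot> a)"
  shows "rigid R f" and "(\<exists>i. a = Var i) \<or> rigid R a"
  using assms by (cases a; auto simp: rigid_def rigid_below_def pattern_App)+

lemma subst_pattern_inj:
  "pattern l \<Longrightarrow> subst \<theta> l = subst \<sigma> l \<Longrightarrow> i \<in> fv l \<Longrightarrow> \<theta> i = \<sigma> i"
  by (induction l) (auto simp: pattern_App)

text \<open>A pattern is not a variable, so matched terms lie strictly inside the instance; the
  diamond proof recurses on them by size.\<close>

lemma size_pattern_var: "pattern l \<Longrightarrow> i \<in> fv l \<Longrightarrow> size (\<theta> i) < size (subst \<theta> l)"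
  by (induction l) (auto simp: pattern_App)

text \<open>The head of a pattern instance is a constant. Used for left-hand sides and their
  subpatterns, the last case excludes overlaps between rules and beta.\<close>

lemma subst_pattern_not:
  "pattern l \<Longrightarrow> subst \<theta> l \<noteq> Var i" "pattern l \<Longrightarrow> subst \<theta> l \<noteq> Type"
  "pattern l \<Longrightarrow> subst \<theta> l \<noteq> Kind" "pattern l \<Longrightarrow> subst \<theta> l \<noteq> Pi A B"
  "pattern l \<Longrightarrow> subst \<theta> l \<noteq> Lam A t" "pattern l \<Longrightarrow> subst \<theta> l \<noteq> Lam A t \<cdot> u"
  by (cases l; auto; auto simp: pattern_App elim: pattern_cases)+

text \<open>This is where linearity enters: substitutions found separately for \<open>f\<close> and
  \<open>a\<close> agree vacuously on shared variables and can be glued.\<close>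

lemma subst_App_merge:
  assumes "fv f \<inter> fv a = {}"
    and "\<And>i. i \<in> fv f \<Longrightarrow> P i (\<theta> i)" and "\<And>i. i \<in> fv a \<Longrightarrow> P i (\<sigma> i)"
  shows "\<exists>\<tau>. subst \<theta> f \<cdot> subst \<sigma> a = subst \<tau> (f \<cdot> a) \<and> (\<forall>i\<in>fv (f \<cdot> a). P i (\<tau> i))"
proof -
  let ?\<tau> = "\<lambda>i. if i \<in> fv f then \<theta> i else \<sigma> i"
  have "subst ?\<tau> f = subst \<theta> f" by (rule subst_cong_fv) simp
  moreover have "subst ?\<tau> a = subst \<sigma> a" by (rule subst_cong_fv) (use assms(1) in auto)
  ultimately show ?thesis using assms by (intro exI [of _ ?\<tau>]) auto
qed

section \<open>Parallel reduction\<close>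

inductive par :: "'c rule set \<Rightarrow> 'c trm \<Rightarrow> 'c trm \<Rightarrow> bool" for R where
  par_Const: "par R (Const c) (Const c)"
| par_Var: "par R (Var i) (Var i)"
| par_Type: "par R Type Type"
| par_Kind: "par R Kind Kind"
| par_Pi: "par R A A' \<Longrightarrow> par R B B' \<Longrightarrow> par R (Pi A B) (Pi A' B')"
| par_Lam: "par R A A' \<Longrightarrow> par R t t' \<Longrightarrow> par R (Lam A t) (Lam A' t')"
| par_App: "par R t t' \<Longrightarrow> par R u u' \<Longrightarrow> par R (t \<cdot> u) (t' \<cdot> u')"
| par_beta: "par R t t' \<Longrightarrow> par R u u' \<Longrightarrow> par R (Lam A t \<cdot> u) (inst u' t')"
| par_rule: "(l, r) \<in> R \<Longrightarrow> (\<forall>i\<in>fv l. par R (\<theta> i) (\<sigma> i)) \<Longrightarrow> par R (subst \<theta> l) (subst \<sigma> r)"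

lemma par_refl: "par R t t"
  by (induction t) (auto intro: par.intros)

lemma par_ren: "par R t u \<Longrightarrow> par R (ren f t) (ren f u)"
proof (induction arbitrary: f rule: par.induct)
  case (par_rule l r \<theta> \<sigma>)
  then show ?case by (auto simp: ren_subst intro!: par.par_rule)
qed (auto simp: ren_inst intro: par_Const par_Var par_Type par_Kind par_Pi par_Lam par_App par_beta)

lemma par_upsubst:
  assumes "\<And>i. par R (\<theta> i) (\<sigma> i)"
  shows "par R (upsubst \<theta> i) (upsubst \<sigma> i)"
  using assms by (cases i) (auto intro: par_ren par_refl)

lemma par_subst:
  "par R t u \<Longrightarrow> (\<And>i. par R (\<theta> i) (\<sigma> i)) \<Longrightarrow> par R (subst \<theta> t) (subst \<sigma> u)"
proof (induction arbitrary: \<theta> \<sigma> rule: par.induct)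
  case (par_rule l r \<theta>' \<sigma>')
  then show ?case by (auto simp: subst_subst intro!: par.par_rule)
next
  case (par_beta t t' u u' A)
  then have "par R (subst (upsubst \<theta>) t) (subst (upsubst \<sigma>) t')" by (simp add: par_upsubst)
  then show ?case using par_beta by (auto simp: subst_inst intro: par.par_beta)
qed (simp_all add: par_Const par_Type par_Kind par_Pi par_Lam par_App par_upsubst)

lemma par_inst: "par R t t' \<Longrightarrow> par R u u' \<Longrightarrow> par R (inst u t) (inst u' t')"
  unfolding inst_eq by (rule par_subst) (auto split: nat.split intro: par_refl)

lemma step_imp_par: "step R t u \<Longrightarrow> par R t u"
  unfolding step_eq
proof (induction rule: cong.induct)
  case (root t u)
  then show ?case
  proof
    assume "beta_root t u"
    then show ?thesis by cases (auto intro: par_beta par_refl)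
  next
    assume "rule_root R t u"
    then show ?thesis by cases (auto intro: par_rule par_refl)
  qed
qed (auto intro: par.intros par_refl)

lemma steps_subst:
  "(\<And>i. i \<in> fv t \<Longrightarrow> (step R)\<^sup>*\<^sup>* (\<theta> i) (\<sigma> i)) \<Longrightarrow> (step R)\<^sup>*\<^sup>* (subst \<theta> t) (subst \<sigma> t)"
proof (induction t arbitrary: \<theta> \<sigma>)
  case (Pi A B)
  have "(step R)\<^sup>*\<^sup>* (upsubst \<theta> i) (upsubst \<sigma> i)" if "i \<in> fv B" for i
    using that Pi.prems
    by (cases i) (auto simp: ren_eq_subst intro: rtranclp_map step_subst)
  then show ?case using Pi by (auto intro!: steps_congs)
next
  case (Lam A B)
  have "(step R)\<^sup>*\<^sup>* (upsubst \<theta> i) (upsubst \<sigma> i)" if "i \<in> fv B" for i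
    using that Lam.prems
    by (cases i) (auto simp: ren_eq_subst intro: rtranclp_map step_subst)
  then show ?case using Lam by (auto intro!: steps_congs)
qed (auto intro!: steps_congs)

lemma par_imp_steps: "par R t u \<Longrightarrow> (step R)\<^sup>*\<^sup>* t u"
proof (induction rule: par.induct)
  case (par_beta t t' u u' A)
  then have "(step R)\<^sup>*\<^sup>* (Lam A t \<cdot> u) (Lam A t' \<cdot> u')" by (auto intro: steps_congs)
  then show ?case using beta_stepI by (rule rtranclp.rtrancl_into_rtrancl)
next
  case (par_rule l r \<theta> \<sigma>)
  \<comment> \<open>The matched terms are reduced first; the redex is still intact and is contracted
    last.\<close>
  then have "(step R)\<^sup>*\<^sup>* (subst \<theta> l) (subst \<sigma> l)" by (auto intro: steps_subst)
  then show ?case using rule_stepI [OF par_rule(1)] by (rule rtranclp.rtrancl_into_rtrancl)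
qed (auto intro: steps_congs)

text \<open>\<open>step\<close> is contained in \<open>par\<close>, and \<open>par\<close> in the
  closure of \<open>step\<close>; confluence may therefore be proved for \<open>par\<close>.\<close>

lemma steps_eq_pars: "(step R)\<^sup>*\<^sup>* = (par R)\<^sup>*\<^sup>*"
proof (intro ext iffI)
  show "(par R)\<^sup>*\<^sup>* t u" if "(step R)\<^sup>*\<^sup>* t u" for t u
    using that step_imp_par by (metis mono_rtranclp)
  show "(step R)\<^sup>*\<^sup>* t u" if "(par R)\<^sup>*\<^sup>* t u" for t u
    using that by induction (auto dest: par_imp_steps)
qed

text \<open>A rule at the root contradicts \<open>clash\<close>, and beta at the root is excluded
  because the function part is a pattern instance. What remains is componentwise reduction, glued by
  linearity.\<close>

lemma par_rigid:
  "rigid R q \<Longrightarrow> par R (subst \<theta> q) u \<Longrightarrow> \<exists>\<sigma>. u = subst \<sigma> q \<and> (\<forall>i\<in>fv q. par R (\<theta> i) (\<sigma> i))"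
proof (induction q arbitrary: u)
  case (Const c)
  have "par R (Const c) u" using Const.prems by simp
  then show ?case
  proof cases
    case (par_rule l r \<theta>' \<sigma>')
    then have "clash (Const c) l" using Const.prems(1) by (auto simp: rigid_def)
    then show ?thesis using par_rule(1) clash_not_unifiable by (metis subst.simps(1))
  qed simp
next
  case (App f a)
  have *: "pattern (f \<cdot> a)" "rigid_below R (f \<cdot> a)" and cl: "\<And>l r. (l, r) \<in> R \<Longrightarrow> clash (f \<cdot> a) l"
    using App.prems(1) by (auto simp: rigid_def)
  have disj: "fv f \<inter> fv a = {}" using *(1) by (simp add: pattern_App)
  have "par R (subst \<theta> f \<cdot> subst \<theta> a) u" using App.prems by simp
  then show ?case
  proof cases
    case (par_App f' a')
    obtain \<sigma>1 where 1: "f' = subst \<sigma>1 f" "\<forall>i\<in>fv f. par R (\<theta> i) (\<sigma>1 i)"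
      using App.IH(1) rigid_below_App(1) [OF *] par_App(2) by blast
    obtain \<sigma>2 where 2: "a' = subst \<sigma>2 a" "\<forall>i\<in>fv a. par R (\<theta> i) (\<sigma>2 i)"
      using rigid_below_App(2) [OF *]
    proof
      assume "\<exists>i. a = Var i"
      then show thesis using that [of "\<lambda>_. a'"] par_App(3) by auto
    qed (use that App.IH(2) par_App(3) in blast)
    show ?thesis
      using subst_App_merge [OF disj, of "\<lambda>i. par R (\<theta> i)" \<sigma>1 \<sigma>2] 1 2 par_App(1) by simp
  next
    case par_beta
    then show ?thesis using *(1) subst_pattern_not(5) by (metis pattern_App)
  next
    case (par_rule l r \<theta>' \<sigma>')
    then show ?thesis using cl clash_not_unifiable [of "f \<cdot> a" l \<theta> \<theta>'] by force
  qed
qed (simp_all add: rigid_def)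

section \<open>Diamond property and confluence\<close>

text \<open>Left-linearity is part of \<open>pattern\<close>; \<open>rigid_below_lhs\<close>
  excludes overlaps below the root, self-overlaps included, and \<open>clash_lhs\<close> those of
  distinct rules at the root.\<close>

locale orthogonal =
  fixes R :: "'c rule set"
  assumes pattern_lhs: "(l, r) \<in> R \<Longrightarrow> pattern l"
    and fv_rhs: "(l, r) \<in> R \<Longrightarrow> fv r \<subseteq> fv l"
    and rigid_below_lhs: "(l, r) \<in> R \<Longrightarrow> rigid_below R l"
    and clash_lhs: "(l, r) \<in> R \<Longrightarrow> (l', r') \<in> R \<Longrightarrow> (l, r) = (l', r') \<or> clash l l'"
begin

text \<open>Nothing overlaps \<open>l\<close> below its root, so a parallel step either contracts
  the redex by this very rule or acts inside the matched terms.\<close>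

lemma par_redex:
  assumes lr: "(l, r) \<in> R" and "par R (subst \<theta> l) u"
  shows "\<exists>\<sigma>. (u = subst \<sigma> l \<or> u = subst \<sigma> r) \<and> (\<forall>i\<in>fv l. par R (\<theta> i) (\<sigma> i))"
  using assms(2)
proof cases
  case (par_rule l' r' \<theta>' \<sigma>)
  then have "l' = l" "r' = r"
    using clash_lhs [OF lr par_rule(3)] clash_not_unifiable [of l l' \<theta> \<theta>'] by auto
  then have "\<forall>i\<in>fv l. \<theta> i = \<theta>' i"
    using par_rule(1) subst_pattern_inj [OF pattern_lhs [OF lr]] by metis
  then show ?thesis using par_rule \<open>l' = l\<close> \<open>r' = r\<close> by metis
next
  case (par_Const c)
  then have "l = Const c" using pattern_lhs [OF lr] by (cases l) auto
  then show ?thesis using par_Const by auto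
next
  case (par_App t t' a a')
  obtain f b where l: "l = f \<cdot> b" and t: "t = subst \<theta> f" and a: "a = subst \<theta> b"
    using par_App(1) pattern_lhs [OF lr] by (cases l) auto
  have *: "pattern (f \<cdot> b)" "rigid_below R (f \<cdot> b)"
    using pattern_lhs rigid_below_lhs lr l by auto
  obtain \<sigma>1 where 1: "t' = subst \<sigma>1 f" "\<forall>i\<in>fv f. par R (\<theta> i) (\<sigma>1 i)"
    using par_rigid [OF rigid_below_App(1) [OF *]] par_App(3) t by blast
  obtain \<sigma>2 where 2: "a' = subst \<sigma>2 b" "\<forall>i\<in>fv b. par R (\<theta> i) (\<sigma>2 i)"
    using rigid_below_App(2) [OF *]
  proof
    assume "\<exists>i. b = Var i"
    then show thesis using that [of "\<lambda>_. a'"] par_App(4) a by auto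
  qed (use that par_rigid par_App(4) a in blast)
  have "fv f \<inter> fv b = {}" using *(1) by (simp add: pattern_App)
  from subst_App_merge [OF this, of "\<lambda>i. par R (\<theta> i)" \<sigma>1 \<sigma>2] show ?thesis
    using 1 2 par_App(2) l by auto
qed (use subst_pattern_not [OF pattern_lhs [OF lr]] in metis)+

lemma par_LamE:
  assumes "par R (Lam A t) u"
  obtains A' t' where "u = Lam A' t'" "par R A A'" "par R t t'"
  using assms
proof cases
  case (par_rule l r \<theta> \<sigma>)
  then show thesis using subst_pattern_not(5) [OF pattern_lhs] by metis
qed (use that in auto)

lemma par_PiE:
  assumes "par R (Pi A B) u"
  obtains A' B' where "u = Pi A' B'" "par R A A'" "par R B B'"
  using assms
proof cases
  case (par_rule l r \<theta> \<sigma>)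
  then show thesis using subst_pattern_not(4) [OF pattern_lhs] by metis
qed (use that in auto)

text \<open>If a rule matches at the root, \<open>par_redex\<close> describes both reducts and the
  matched terms are joined by induction on size. Otherwise beta is the only possible root
  contraction.\<close>

lemma par_diamond: "par R t u \<Longrightarrow> par R t v \<Longrightarrow> \<exists>w. par R u w \<and> par R v w"
proof (induction t arbitrary: u v rule: measure_induct_rule [of size])
  case (less t)
  show ?case
  proof (cases "\<exists>l r \<theta>. (l, r) \<in> R \<and> t = subst \<theta> l")
    case True
    then obtain l r \<theta> where lr: "(l, r) \<in> R" and t: "t = subst \<theta> l" by blast
    obtain \<sigma> where u: "u = subst \<sigma> l \<or> u = subst \<sigma> r" "\<And>i. i \<in> fv l \<Longrightarrow> par R (\<theta> i) (\<sigma> i)"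
      using par_redex [OF lr] less.prems(1) t by metis
    obtain \<tau> where v: "v = subst \<tau> l \<or> v = subst \<tau> r" "\<And>i. i \<in> fv l \<Longrightarrow> par R (\<theta> i) (\<tau> i)"
      using par_redex [OF lr] less.prems(2) t by metis
    have "\<exists>w. par R (\<sigma> i) w \<and> par R (\<tau> i) w" if "i \<in> fv l" for i
      using less.IH [of "\<theta> i"] size_pattern_var [OF pattern_lhs [OF lr] that] u(2) v(2) that t
      by blast
    then obtain \<rho> where \<rho>: "\<And>i. i \<in> fv l \<Longrightarrow> par R (\<sigma> i) (\<rho> i) \<and> par R (\<tau> i) (\<rho> i)" by metis
    \<comment> \<open>Both reducts meet in the contracted instance, whether or not they have already
      contracted the redex.\<close>
    have join: "par R x (subst \<rho> r)"
      if x: "x = subst \<xi> l \<or> x = subst \<xi> r" and \<xi>: "\<And>i. i \<in> fv l \<Longrightarrow> par R (\<xi> i) (\<rho> i)" for x \<xi>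
      using x
    proof
      assume "x = subst \<xi> l"
      then show ?thesis using \<xi> par_rule [OF lr] by blast
    next
      \<comment> \<open>\<open>\<rho>\<close> is arbitrary outside \<open>fv l\<close>; keeping
        \<open>\<xi>\<close> there makes \<open>par_subst\<close> applicable at every index, and
        \<open>r\<close>, having only variables of \<open>l\<close>, does not see the
        change.\<close>
      let ?\<rho> = "\<lambda>i. if i \<in> fv l then \<rho> i else \<xi> i"
      assume "x = subst \<xi> r"
      moreover have "par R (subst \<xi> r) (subst ?\<rho> r)"
        using \<xi> by (auto intro!: par_subst par_refl)
      moreover have "subst ?\<rho> r = subst \<rho> r"
        by (rule subst_cong_fv) (use fv_rhs [OF lr] in auto)
      ultimately show ?thesis by simp
    qed
    show ?thesis using join [OF u(1)] join [OF v(1)] \<rho> by blast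
  next
    case False
    have IH: "\<exists>w. par R x w \<and> par R y w" if "size s < size t" "par R s x" "par R s y" for s x y
      using less.IH that by blast
    \<comment> \<open>One reduct contracts the root beta redex. If \<open>v\<close> does not, its
      function part is still an abstraction, by \<open>par_LamE\<close>. Stated for all
      \<open>u\<close> and \<open>v\<close>, this covers both orders.\<close>
    have beta: "\<exists>w. par R u w \<and> par R v w"
      if t: "t = Lam A b \<cdot> a" and u: "u = inst a' b'" and b: "par R b b'" and a: "par R a a'"
        and v: "par R t v" for A b a u v a' b'
      using v
    proof cases
      case (par_App f f' c c')
      then have "par R (Lam A b) f'" "par R a c'" using t by auto
      then obtain A' b'' where f': "f' = Lam A' b''" "par R b b''" using par_LamE by blast
      then obtain w1 w2 where "par R b' w1" "par R b'' w1" "par R a' w2" "par R c' w2"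
        using IH [of b b' b''] IH [of a a' c'] a b t \<open>par R a c'\<close> by auto
      then show ?thesis using par_App f' u by (blast intro: par_inst par.par_beta)
    next
      case (par_beta b1 b'' c a'' A1)
      then obtain w1 w2 where "par R b' w1" "par R b'' w1" "par R a' w2" "par R a'' w2"
        using IH [of b b' b''] IH [of a a' a''] a b t by auto
      then show ?thesis using par_beta u by (blast intro: par_inst)
    qed (use False t in auto)
    from less.prems(1) show ?thesis
    proof cases
      case (par_beta b b' a a' A)
      then show ?thesis using beta less.prems(2) by blast
    next
      case u: (par_App f f' a a')
      from less.prems(2) show ?thesis
      proof cases
        case (par_beta b b' a a' A)
        then show ?thesis using beta less.prems(1) by blast
      next
        case (par_App g g' c c')
        then obtain w1 w2 where "par R f' w1" "par R g' w1" "par R a' w2" "par R c' w2"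
          using IH [of f f' g'] IH [of a a' c'] u by auto
        then show ?thesis using par_App u by (blast intro: par.par_App)
      qed (use False u in auto)
    next
      case u: (par_Pi f f' a a')
      from less.prems(2) show ?thesis
      proof cases
        case (par_Pi g g' c c')
        then obtain w1 w2 where "par R f' w1" "par R g' w1" "par R a' w2" "par R c' w2"
          using IH [of f f' g'] IH [of a a' c'] u by auto
        then show ?thesis using par_Pi u by (blast intro: par.par_Pi)
      qed (use False u in auto)
    next
      case u: (par_Lam f f' a a')
      from less.prems(2) show ?thesis
      proof cases
        case (par_Lam g g' c c')
        then obtain w1 w2 where "par R f' w1" "par R g' w1" "par R a' w2" "par R c' w2"
          using IH [of f f' g'] IH [of a a' c'] u by auto
        then show ?thesis using par_Lam u by (blast intro: par.par_Lam)
      qed (use False u in auto)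
    qed (use False less.prems(2) in \<open>auto intro: par_refl elim: par.cases\<close>)
  qed
qed

lemma confluentp_step: "confluentp (step R)"
proof -
  have "confluentp (par R)"
    by (rule strong_confluentp_imp_confluentp, rule strong_confluentpI) (use par_diamond in blast)
  then show ?thesis
    unfolding confluentp_def rtranclp_conversep steps_eq_pars .
qed

section \<open>Injectivity up to conversion\<close>

lemma convertible_joinable:
  assumes "convertible R t u"
  obtains w where "(par R)\<^sup>*\<^sup>* t w" and "(par R)\<^sup>*\<^sup>* u w"
  using assms semiconfluentp_equivclp [OF confluentp_imp_semiconfluentp [OF confluentp_step]]
  by (auto simp: rtranclp_conversep steps_eq_pars)

lemma pars_PiE:
  assumes "(par R)\<^sup>*\<^sup>* (Pi A B) u"
  obtains A' B' where "u = Pi A' B'" "(par R)\<^sup>*\<^sup>* A A'" "(par R)\<^sup>*\<^sup>* B B'"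
proof -
  have "\<exists>A' B'. u = Pi A' B' \<and> (par R)\<^sup>*\<^sup>* A A' \<and> (par R)\<^sup>*\<^sup>* B B'"
    using assms
  proof induction
    case (step u v)
    then show ?case by (metis par_PiE rtranclp.rtrancl_into_rtrancl)
  qed simp
  then show thesis using that by blast
qed

text \<open>No root contraction applies to a product, so a common reduct is a product and is
  compared componentwise.\<close>

lemma convertible_Pi_inj:
  assumes "convertible R (Pi A B) (Pi A' B')"
  shows "convertible R A A'" and "convertible R B B'"
proof -
  obtain w where "(par R)\<^sup>*\<^sup>* (Pi A B) w" "(par R)\<^sup>*\<^sup>* (Pi A' B') w"
    using convertible_joinable [OF assms] .
  then obtain A'' B'' where "(par R)\<^sup>*\<^sup>* A A''" "(par R)\<^sup>*\<^sup>* A' A''"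
    "(par R)\<^sup>*\<^sup>* B B''" "(par R)\<^sup>*\<^sup>* B' B''"
    by (auto elim!: pars_PiE)
  then show "convertible R A A'" "convertible R B B'"
    by (auto intro: convertible_if_joinable simp: steps_eq_pars)
qed

lemma pars_rigid:
  assumes q: "rigid R q" and "(par R)\<^sup>*\<^sup>* (subst \<theta> q) u"
  shows "\<exists>\<sigma>. u = subst \<sigma> q \<and> (\<forall>i\<in>fv q. (par R)\<^sup>*\<^sup>* (\<theta> i) (\<sigma> i))"
  using assms(2)
proof induction
  case (step u v)
  then show ?case using par_rigid [OF q] by (metis rtranclp.rtrancl_into_rtrancl)
qed auto

text \<open>A common reduct is an instance of \<open>q\<close> in two ways, and
  \<open>subst_pattern_inj\<close> identifies the two substitutions on the variables of
  \<open>q\<close>.\<close>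

lemma convertible_rigid_inj:
  assumes q: "rigid R q" and "convertible R (subst \<theta> q) (subst \<sigma> q)" and i: "i \<in> fv q"
  shows "convertible R (\<theta> i) (\<sigma> i)"
proof -
  obtain w where w: "(par R)\<^sup>*\<^sup>* (subst \<theta> q) w" "(par R)\<^sup>*\<^sup>* (subst \<sigma> q) w"
    using convertible_joinable [OF assms(2)] .
  obtain \<theta>' \<sigma>' where "w = subst \<theta>' q" "(par R)\<^sup>*\<^sup>* (\<theta> i) (\<theta>' i)"
    and "w = subst \<sigma>' q" "(par R)\<^sup>*\<^sup>* (\<sigma> i) (\<sigma>' i)"
    using pars_rigid [OF q w(1)] pars_rigid [OF q w(2)] i by blast
  then show ?thesis
    using subst_pattern_inj [of q \<theta>' \<sigma>' i] q i
    by (metis convertible_if_joinable rigid_def steps_eq_pars)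
qed

end


subsection \<open>Typing\<close>

locale closed_signature =
  fixes S :: "'c signature" and R :: "'c rule set"
  assumes closed: "(c, A) \<in> set S \<Longrightarrow> fv A = {}"
begin

abbreviation wf :: "'c trm list \<Rightarrow> bool" where
  "wf \<equiv> wf_ctx S R"

abbreviation typing :: "'c trm list \<Rightarrow> 'c trm \<Rightarrow> 'c trm \<Rightarrow> bool"  ("_ \<turnstile> _ : _" [51, 51, 51] 50) where
  "\<Gamma> \<turnstile> t : A \<equiv> has_type S R \<Gamma> t A"

lemma typing_wf: "\<Gamma> \<turnstile> t : A \<Longrightarrow> wf \<Gamma>"
  by (induction rule: wf_ctx_has_type.inducts(2) [where ?P1.0 = "\<lambda>_. True"]) auto

lemma Kind_untypable: "\<not> \<Gamma> \<turnstile> Kind : A"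
proof
  assume "\<Gamma> \<turnstile> Kind : A"
  then show False
    by (induction \<Gamma> "Kind :: 'c trm" A rule: wf_ctx_has_type.inducts(2) [where ?P1.0 = "\<lambda>_. True"])
      auto
qed

section \<open>Weakening and substitution for typing\<close>

text \<open>Weakening is the case \<open>Suc\<close>; arbitrary \<open>f\<close> is allowed so that
  the notion survives passing under a binder.\<close>

definition renames :: "(nat \<Rightarrow> nat) \<Rightarrow> 'c trm list \<Rightarrow> 'c trm list \<Rightarrow> bool" where
  "renames f \<Gamma> \<Delta> \<longleftrightarrow> (\<forall>i<length \<Gamma>. f i < length \<Delta> \<and>
    lift (Suc (f i)) (\<Delta> ! f i) = ren f (lift (Suc i) (\<Gamma> ! i)))"

lemma renames_upren: "renames f \<Gamma> \<Delta> \<Longrightarrow> renames (upren f) (A # \<Gamma>) (ren f A # \<Delta>)"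
  unfolding renames_def
proof (intro allI impI)
  fix i assume *: "\<forall>i<length \<Gamma>. f i < length \<Delta> \<and>
    lift (Suc (f i)) (\<Delta> ! f i) = ren f (lift (Suc i) (\<Gamma> ! i))" "i < length (A # \<Gamma>)"
  show "upren f i < length (ren f A # \<Delta>) \<and>
    lift (Suc (upren f i)) ((ren f A # \<Delta>) ! upren f i) =
    ren (upren f) (lift (Suc i) ((A # \<Gamma>) ! i))"
  proof (cases i)
    case 0
    then show ?thesis by (simp add: lift_1 ren_upren_Suc)
  next
    case (Suc j)
    then show ?thesis
      using * by (simp add: lift_Suc [of "Suc _"] ren_upren_Suc)
  qed
qed

lemma typing_ren: "\<Gamma> \<turnstile> t : A \<Longrightarrow> wf \<Delta> \<Longrightarrow> renames f \<Gamma> \<Delta> \<Longrightarrow> \<Delta> \<turnstile> ren f t : ren f A"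
proof (induction arbitrary: \<Delta> f rule: wf_ctx_has_type.inducts(2) [where ?P1.0 = "\<lambda>_. True"])
  case (const \<Gamma> A s c)
  then show ?case using wf_ctx_has_type.const closed by (simp add: ren_closed)
next
  case (var \<Gamma> i)
  then show ?case using wf_ctx_has_type.var [of S R \<Delta> "f i"] by (simp add: renames_def)
next
  case (prod \<Gamma> A B s)
  have A: "\<Delta> \<turnstile> ren f A : Type" using prod.IH(1) [OF prod.prems] by simp
  \<comment> \<open>The extended context is well-formed because its new entry has just been typed,
    so the induction can use a trivial statement about contexts.\<close>
  moreover have "wf (ren f A # \<Delta>)" using wf_ctx_has_type.decl [OF A] by simp
  then have "ren f A # \<Delta> \<turnstile> ren (upren f) B : s"
    using prod.IH(2) prod.prems(2) prod.hyps(3) renames_upren by fastforce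
  ultimately show ?case using wf_ctx_has_type.prod prod.hyps(3) by fastforce
next
  case (abs \<Gamma> A B s t)
  have A: "\<Delta> \<turnstile> ren f A : Type" using abs.IH(1) [OF abs.prems] by simp
  have wf: "wf (ren f A # \<Delta>)" using wf_ctx_has_type.decl [OF A] by simp
  have "ren f A # \<Delta> \<turnstile> ren (upren f) B : s"
    using abs.IH(2) wf abs.prems(2) abs.hyps(3) renames_upren by fastforce
  moreover have "ren f A # \<Delta> \<turnstile> ren (upren f) t : ren (upren f) B"
    using abs.IH(3) wf abs.prems(2) renames_upren by fastforce
  ultimately show ?case using wf_ctx_has_type.abs A abs.hyps(3) by fastforce
next
  case (app \<Gamma> t A B u)
  then show ?case using wf_ctx_has_type.app by (fastforce simp: ren_inst)
next
  case (conv \<Gamma> t A B s)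
  have "\<Delta> \<turnstile> ren f B : s" using conv.IH(2) conv.prems conv.hyps(3) by fastforce
  then show ?case
    using wf_ctx_has_type.conv conv.IH(1) conv.prems conv.hyps convertible_ren by metis
qed (auto intro: wf_ctx_has_type.intros)

lemma typing_weaken:
  assumes "\<Gamma> \<turnstile> t : A" and "wf (B # \<Gamma>)"
  shows "B # \<Gamma> \<turnstile> ren Suc t : ren Suc A"
proof -
  have "renames Suc \<Gamma> (B # \<Gamma>)" by (simp add: renames_def lift_Suc [of "Suc _"])
  then show ?thesis using typing_ren assms by blast
qed

lemma typing_closed:
  assumes "[] \<turnstile> t : A" and "wf \<Delta>" and "fv t = {}" and "fv A = {}"
  shows "\<Delta> \<turnstile> t : A"
  using typing_ren [OF assms(1,2), of id] assms(3,4) by (simp add: renames_def ren_closed)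

lemma typing_upsubst:
  assumes \<theta>: "\<And>i. i < length \<Gamma> \<Longrightarrow> \<Delta> \<turnstile> \<theta> i : subst \<theta> (lift (Suc i) (\<Gamma> ! i))"
    and wf: "wf (subst \<theta> A # \<Delta>)" and i: "i < length (A # \<Gamma>)"
  shows "subst \<theta> A # \<Delta> \<turnstile> upsubst \<theta> i : subst (upsubst \<theta>) (lift (Suc i) ((A # \<Gamma>) ! i))"
proof (cases i)
  case 0
  then show ?thesis
    using wf_ctx_has_type.var [OF wf, of 0] by (simp add: lift_1 subst_upsubst_Suc)
next
  case (Suc j)
  then show ?thesis
    using typing_weaken [OF \<theta> wf] i by (simp add: lift_Suc [of "Suc _"] subst_upsubst_Suc)
qed

lemma typing_subst:
  "\<Gamma> \<turnstile> t : A \<Longrightarrow> wf \<Delta> \<Longrightarrow> (\<And>i. i < length \<Gamma> \<Longrightarrow> \<Delta> \<turnstile> \<theta> i : subst \<theta> (lift (Suc i) (\<Gamma> ! i))) \<Longrightarrow>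
    \<Delta> \<turnstile> subst \<theta> t : subst \<theta> A"
proof (induction arbitrary: \<Delta> \<theta> rule: wf_ctx_has_type.inducts(2) [where ?P1.0 = "\<lambda>_. True"])
  case (const \<Gamma> A s c)
  then show ?case using wf_ctx_has_type.const closed by (simp add: subst_closed)
next
  case (prod \<Gamma> A B s)
  have A: "\<Delta> \<turnstile> subst \<theta> A : Type" using prod.IH(1) [OF prod.prems] by simp
  have wf: "wf (subst \<theta> A # \<Delta>)" using wf_ctx_has_type.decl [OF A] by simp
  have "subst \<theta> A # \<Delta> \<turnstile> subst (upsubst \<theta>) B : subst (upsubst \<theta>) s"
    by (rule prod.IH(2) [OF wf]) (rule typing_upsubst [OF prod.prems(2) wf])
  then show ?case using wf_ctx_has_type.prod [OF A] prod.hyps(3) by fastforce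
next
  case (abs \<Gamma> A B s t)
  have A: "\<Delta> \<turnstile> subst \<theta> A : Type" using abs.IH(1) [OF abs.prems] by simp
  have wf: "wf (subst \<theta> A # \<Delta>)" using wf_ctx_has_type.decl [OF A] by simp
  have "subst \<theta> A # \<Delta> \<turnstile> subst (upsubst \<theta>) B : subst (upsubst \<theta>) s"
    by (rule abs.IH(2) [OF wf]) (rule typing_upsubst [OF abs.prems(2) wf])
  moreover have "subst \<theta> A # \<Delta> \<turnstile> subst (upsubst \<theta>) t : subst (upsubst \<theta>) B"
    by (rule abs.IH(3) [OF wf]) (rule typing_upsubst [OF abs.prems(2) wf])
  ultimately show ?case using wf_ctx_has_type.abs [OF A] abs.hyps(3) by fastforce
next
  case (app \<Gamma> t A B u)
  have "\<Delta> \<turnstile> subst \<theta> t : subst \<theta> (Pi A B)" "\<Delta> \<turnstile> subst \<theta> u : subst \<theta> A"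
    using app.IH app.prems by blast+
  then show ?case using wf_ctx_has_type.app by (fastforce simp: subst_inst)
next
  case (conv \<Gamma> t A B s)
  have "\<Delta> \<turnstile> subst \<theta> B : subst \<theta> s" "\<Delta> \<turnstile> subst \<theta> t : subst \<theta> A"
    using conv.IH conv.prems by blast+
  moreover have "subst \<theta> s = s" using conv.hyps(3) by auto
  ultimately show ?case
    using wf_ctx_has_type.conv conv.hyps(3,4) convertible_subst by metis
qed (auto intro: wf_ctx_has_type.intros)

lemma typing_inst:
  assumes B: "A # \<Gamma> \<turnstile> B : C" and u: "\<Gamma> \<turnstile> u : A"
  shows "\<Gamma> \<turnstile> inst u B : inst u C"
  unfolding inst_eq
proof (rule typing_subst [OF B typing_wf [OF u]])
  fix i assume i: "i < length (A # \<Gamma>)"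
  have tail: "subst (case_nat u Var) (ren Suc t) = t" for t
    using inst_ren_Suc by (simp add: inst_eq)
  show "\<Gamma> \<turnstile> case_nat u Var i : subst (case_nat u Var) (lift (Suc i) ((A # \<Gamma>) ! i))"
  proof (cases i)
    case 0
    then show ?thesis using u by (simp add: lift_1 tail)
  next
    case (Suc j)
    then show ?thesis
      using i wf_ctx_has_type.var [OF typing_wf [OF u]] by (simp add: lift_Suc [of "Suc _"] tail)
  qed
qed

section \<open>Inversion and typability of types\<close>

lemma typing_ConstE:
  assumes "\<Gamma> \<turnstile> Const c : T"
  obtains A where "(c, A) \<in> set S" and "convertible R A T"
proof -
  from assms have "\<exists>A. (c, A) \<in> set S \<and> convertible R A T"
  proof (induction \<Gamma> "Const c" T
      rule: wf_ctx_has_type.inducts(2) [where ?P1.0 = "\<lambda>_. True", consumes 1])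
    case (conv \<Gamma> A B s)
    then show ?case by (meson equivclp_trans)
  qed auto
  then show thesis using that by blast
qed

lemma typing_AppE:
  assumes "\<Gamma> \<turnstile> t \<cdot> u : T"
  obtains A B where "\<Gamma> \<turnstile> t : Pi A B" and "\<Gamma> \<turnstile> u : A" and "convertible R (inst u B) T"
proof -
  from assms have "\<exists>A B. \<Gamma> \<turnstile> t : Pi A B \<and> \<Gamma> \<turnstile> u : A \<and> convertible R (inst u B) T"
  proof (induction \<Gamma> "t \<cdot> u" T
      rule: wf_ctx_has_type.inducts(2) [where ?P1.0 = "\<lambda>_. True", consumes 1])
    case (conv \<Gamma> A B s)
    then show ?case by (meson equivclp_trans)
  next
    case (app \<Gamma> A B)
    then show ?case by (meson equivclp_refl)
  qed auto
  then show thesis using that by blast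
qed

lemma typing_PiE:
  assumes "\<Gamma> \<turnstile> Pi A B : T"
  obtains s where "\<Gamma> \<turnstile> A : Type" and "A # \<Gamma> \<turnstile> B : s" and "s \<in> {Type, Kind}"
proof -
  from assms have "\<exists>s. \<Gamma> \<turnstile> A : Type \<and> A # \<Gamma> \<turnstile> B : s \<and> s \<in> {Type, Kind}"
    by (induction \<Gamma> "Pi A B" T
      rule: wf_ctx_has_type.inducts(2) [where ?P1.0 = "\<lambda>_. True", consumes 1]) auto
  then show thesis using that by blast
qed

lemma wf_nth_typable:
  "wf \<Gamma> \<Longrightarrow> i < length \<Gamma> \<Longrightarrow> \<exists>s\<in>{Type, Kind}. \<Gamma> \<turnstile> lift (Suc i) (\<Gamma> ! i) : s"
proof (induction \<Gamma> arbitrary: i)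
  case (Cons A \<Gamma>)
  from Cons.prems(1) obtain s where A: "\<Gamma> \<turnstile> A : s" "s \<in> {Type, Kind}"
    by cases auto
  show ?case
  proof (cases i)
    case 0
    then show ?thesis
      using typing_weaken [OF A(1) Cons.prems(1)] A(2) by (auto simp: lift_1)
  next
    case (Suc j)
    then obtain s' where "\<Gamma> \<turnstile> lift (Suc j) (\<Gamma> ! j) : s'" "s' \<in> {Type, Kind}"
      using Cons.IH [of j] Cons.prems(2) typing_wf [OF A(1)] by auto
    then show ?thesis
      using typing_weaken [OF _ Cons.prems(1)] Suc by (fastforce simp: lift_Suc [of "Suc _"])
  qed
qed simp

text \<open>\<open>Kind\<close> has no type, hence the exception. For an application, inverting the
  typable product gives a sort for the codomain, which instantiation preserves.\<close>

lemma type_typable: "\<Gamma> \<turnstile> t : A \<Longrightarrow> A = Kind \<or> (\<exists>s\<in>{Type, Kind}. \<Gamma> \<turnstile> A : s)"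
proof (induction rule: wf_ctx_has_type.inducts(2) [where ?P1.0 = "\<lambda>_. True", consumes 1])
  case (const \<Gamma> A s c)
  then have "\<Gamma> \<turnstile> A : s" using typing_closed closed by fastforce
  then show ?case using const by blast
next
  case (var \<Gamma> i)
  then show ?case using wf_nth_typable by blast
next
  case (prod \<Gamma> A B s)
  then show ?case using wf_ctx_has_type.sort typing_wf by blast
next
  case (abs \<Gamma> A B s t)
  then show ?case using wf_ctx_has_type.prod by blast
next
  case (app \<Gamma> t A B u)
  then obtain s where "A # \<Gamma> \<turnstile> B : s" "s \<in> {Type, Kind}" by (auto elim: typing_PiE)
  moreover have "inst u s = s" using calculation(2) by (auto simp: inst_eq)
  ultimately show ?case using typing_inst app.hyps(2) by metis
qed auto

text \<open>Types of constants and variables are typable, and \<open>inst u B = Kind\<close> would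
  force \<open>B\<close> or \<open>u\<close> to be the untypable \<open>Kind\<close>. Consequently
  no pattern instance has type \<open>Kind\<close>.\<close>

lemma typing_Kind_shape: "\<Gamma> \<turnstile> t : Kind \<Longrightarrow> t = Type \<or> (\<exists>A B. t = Pi A B)"
proof (induction \<Gamma> t "Kind :: 'c trm"
    rule: wf_ctx_has_type.inducts(2) [where ?P1.0 = "\<lambda>_. True", consumes 1])
  case (const \<Gamma> s c)
  then show ?case using Kind_untypable by blast
next
  case (var \<Gamma> i)
  then show ?case using wf_nth_typable Kind_untypable by metis
next
  case (app \<Gamma> t A B u)
  then obtain s where B: "A # \<Gamma> \<turnstile> B : s"
    using type_typable [OF app.hyps(1)] by (auto elim: typing_PiE)
  have "B = Kind \<or> u = Kind" using app.hyps(4)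
    by (auto simp: inst_eq subst_eq_Kind gr0_conv_Suc split: nat.splits)
  then show ?case using B app.hyps(1-3) Kind_untypable by blast
next
  case (conv \<Gamma> t A s)
  then show ?case using Kind_untypable by blast
qed auto

end


subsection \<open>Conversion-free type inference\<close>

text \<open>Unlike the entries of a context list, those of an environment live in the scope of all
  variables, so a new binder lifts every entry, its own type included.\<close>

definition extend :: "'c trm \<Rightarrow> (nat \<Rightarrow> 'c trm option) \<Rightarrow> nat \<Rightarrow> 'c trm option" where
  "extend A P i = map_option (lift 1) (case i of 0 \<Rightarrow> Some A | Suc j \<Rightarrow> P j)"

text \<open>Types are compared syntactically. Under \<open>Lam\<close>, a body type
  \<open>Kind\<close> would give an untypable product, and a variable could become
  \<open>Kind\<close> under a substitution; both are rejected.\<close>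

primrec infer ::
  "('c \<Rightarrow> 'c trm option) \<Rightarrow> (nat \<Rightarrow> 'c trm option) \<Rightarrow> 'c trm \<Rightarrow> 'c trm option" where
  "infer ty P (Const c) = ty c"
| "infer ty P (Var i) = P i"
| "infer ty P Type = Some Kind"
| "infer ty P Kind = None"
| "infer ty P (Pi A B) = (if infer ty P A = Some Type
    then (case infer ty (extend A P) B of
      Some Type \<Rightarrow> Some Type | Some Kind \<Rightarrow> Some Kind | _ \<Rightarrow> None)
    else None)"
| "infer ty P (Lam A t) = (if infer ty P A = Some Type
    then (case infer ty (extend A P) t of
      None \<Rightarrow> None | Some Kind \<Rightarrow> None | Some (Var i) \<Rightarrow> None | Some B \<Rightarrow> Some (Pi A B))
    else None)"
| "infer ty P (f \<cdot> a) = (case infer ty P f of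
    Some (Pi A B) \<Rightarrow> if infer ty P a = Some A then Some (inst a B) else None | _ \<Rightarrow> None)"

text \<open>Arguments are not checked against the domains: that they have these types is deduced in
  \<open>lhs_sound\<close> from the assumed typing of the instance.\<close>

primrec lhs_type :: "('c \<Rightarrow> 'c trm option) \<Rightarrow> 'c trm \<Rightarrow> 'c trm option" where
  "lhs_type ty (Const c) = ty c"
| "lhs_type ty (Var i) = None"
| "lhs_type ty Type = None"
| "lhs_type ty Kind = None"
| "lhs_type ty (Pi A B) = None"
| "lhs_type ty (Lam A t) = None"
| "lhs_type ty (f \<cdot> a) = (case lhs_type ty f of
    Some (Pi A B) \<Rightarrow>
      if (case a of Var i \<Rightarrow> True | _ \<Rightarrow> lhs_type ty a \<noteq> None) then Some (inst a B) else None
  | _ \<Rightarrow> None)"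

primrec lhs_env :: "('c \<Rightarrow> 'c trm option) \<Rightarrow> 'c trm \<Rightarrow> nat \<Rightarrow> 'c trm option" where
  "lhs_env ty (Const c) = Map.empty"
| "lhs_env ty (Var i) = Map.empty"
| "lhs_env ty Type = Map.empty"
| "lhs_env ty Kind = Map.empty"
| "lhs_env ty (Pi A B) = Map.empty"
| "lhs_env ty (Lam A t) = Map.empty"
| "lhs_env ty (f \<cdot> a) = lhs_env ty f ++ (case a of
    Var i \<Rightarrow> (case lhs_type ty f of Some (Pi A B) \<Rightarrow> [i \<mapsto> A] | _ \<Rightarrow> Map.empty)
  | _ \<Rightarrow> lhs_env ty a)"

lemma lhs_type_AppE:
  assumes "lhs_type ty (f \<cdot> a) = Some T"
  obtains A B where "lhs_type ty f = Some (Pi A B)" and "T = inst a B"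
    and "(\<exists>i. a = Var i \<and> lhs_env ty (f \<cdot> a) = lhs_env ty f ++ [i \<mapsto> A]) \<or>
      (\<exists>T'. lhs_type ty a = Some T') \<and> lhs_env ty (f \<cdot> a) = lhs_env ty f ++ lhs_env ty a"
proof -
  obtain A B where f: "lhs_type ty f = Some (Pi A B)"
  proof (cases "lhs_type ty f")
    case (Some C)
    then show thesis using assms that by (cases C) simp_all
  qed (use assms in simp)
  show thesis
    by (rule that [OF f]) (use assms f in \<open>cases a; force split: if_splits\<close>)+
qed

context closed_signature
begin

lemma env_extend:
  assumes "\<And>i T. P i = Some T \<Longrightarrow> \<Gamma> \<turnstile> \<theta> i : subst \<theta> T" and wf: "wf (subst \<theta> A # \<Gamma>)"
    and "extend A P i = Some T"
  shows "subst \<theta> A # \<Gamma> \<turnstile> upsubst \<theta> i : subst (upsubst \<theta>) T"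
proof (cases i)
  case 0
  then show ?thesis
    using wf_ctx_has_type.var [OF wf, of 0] assms(3)
    by (auto simp: extend_def lift_1 subst_upsubst_Suc)
next
  case (Suc j)
  then show ?thesis
    using typing_weaken [OF assms(1) wf] assms(3)
    by (auto simp: extend_def lift_1 subst_upsubst_Suc)
qed

text \<open>Each successful case of \<open>infer\<close> is one typing rule. Assuming declarations
  only for the constants of \<open>t\<close> makes this usable in a fragment, while
  \<open>\<theta>\<close> lets pattern variables stand for well-typed terms.\<close>

lemma infer_sound:
  assumes "\<And>c. c \<in> constants t \<Longrightarrow>
      \<exists>A s. ty c = Some A \<and> (c, A) \<in> set S \<and> [] \<turnstile> A : s \<and> s \<in> {Type, Kind}"
    and "wf \<Gamma>" and "\<And>i A. P i = Some A \<Longrightarrow> \<Gamma> \<turnstile> \<theta> i : subst \<theta> A" and "infer ty P t = Some T"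
  shows "\<Gamma> \<turnstile> subst \<theta> t : subst \<theta> T"
  using assms
proof (induction t arbitrary: \<Gamma> P \<theta> T)
  case (Const c)
  then show ?case by (fastforce simp: subst_closed closed intro: wf_ctx_has_type.const)
next
  case Type
  then show ?case by (auto intro: wf_ctx_has_type.sort)
next
  case (Pi A B)
  have "infer ty P A = Some Type" using Pi.prems(4) by (auto split: if_splits)
  then have A: "\<Gamma> \<turnstile> subst \<theta> A : Type" using Pi.IH(1) [OF _ Pi.prems(2,3)] Pi.prems(1) by fastforce
  have B: "infer ty (extend A P) B = Some T" and T: "T \<in> {Type, Kind}"
    using Pi.prems(4) by (auto split: if_splits option.splits trm.splits)
  have wf: "wf (subst \<theta> A # \<Gamma>)" using wf_ctx_has_type.decl [OF A] by simp
  have "subst \<theta> A # \<Gamma> \<turnstile> subst (upsubst \<theta>) B : subst (upsubst \<theta>) T"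
    by (rule Pi.IH(2) [OF _ wf _ B]) (use Pi.prems(1) env_extend [OF Pi.prems(3) wf] in auto)
  then show ?case using wf_ctx_has_type.prod [OF A] T by auto
next
  case (Lam A t)
  have "infer ty P A = Some Type" using Lam.prems(4) by (auto split: if_splits)
  then have A: "\<Gamma> \<turnstile> subst \<theta> A : Type"
    using Lam.IH(1) [OF _ Lam.prems(2,3)] Lam.prems(1) by fastforce
  obtain B where B: "infer ty (extend A P) t = Some B" and T: "T = Pi A B"
    and "B \<noteq> Kind" "\<forall>i. B \<noteq> Var i"
    using Lam.prems(4) by (auto split: if_splits option.splits trm.splits)
  \<comment> \<open>\<open>abs\<close> asks for a sort of the body type, which exists once that type
    is not \<open>Kind\<close>.\<close>
  then have no_Kind: "subst (upsubst \<theta>) B \<noteq> Kind" by (simp add: subst_eq_Kind)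
  have wf: "wf (subst \<theta> A # \<Gamma>)" using wf_ctx_has_type.decl [OF A] by simp
  have t: "subst \<theta> A # \<Gamma> \<turnstile> subst (upsubst \<theta>) t : subst (upsubst \<theta>) B"
    by (rule Lam.IH(2) [OF _ wf _ B]) (use Lam.prems(1) env_extend [OF Lam.prems(3) wf] in auto)
  then obtain s where "subst \<theta> A # \<Gamma> \<turnstile> subst (upsubst \<theta>) B : s" "s \<in> {Type, Kind}"
    using type_typable no_Kind by blast
  then show ?case using wf_ctx_has_type.abs [OF A] t T by simp
next
  case (App f a)
  obtain A B where f: "infer ty P f = Some (Pi A B)" and a: "infer ty P a = Some A"
    and T: "T = inst a B"
    using App.prems(4) by (auto split: if_splits option.splits trm.splits)
  have "\<Gamma> \<turnstile> subst \<theta> f : Pi (subst \<theta> A) (subst (upsubst \<theta>) B)"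
    using App.IH(1) [OF _ App.prems(2,3) f] App.prems(1) by simp
  moreover have "\<Gamma> \<turnstile> subst \<theta> a : subst \<theta> A"
    using App.IH(2) [OF _ App.prems(2,3) a] App.prems(1) by simp
  ultimately show ?case using wf_ctx_has_type.app T by (fastforce simp: subst_inst)
qed simp_all

end


section \<open>Typing of left-hand sides and preservation of typing\<close>

locale orthogonal_system = orthogonal R + closed_signature S R
  for S :: "'c signature" and R :: "'c rule set"
begin

text \<open>Inversion gives \<open>f\<close> some product type, convertible to the inferred one by
  induction; injectivity of products then compares domains and codomains. A sort for the inferred
  type is carried along because \<open>conv\<close> asks for it.\<close>

lemma lhs_sound:
  assumes "\<And>c A. (c, A) \<in> set S \<Longrightarrow> ty c = Some A \<and> (\<exists>s\<in>{Type, Kind}. [] \<turnstile> A : s)"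
    and "\<Gamma> \<turnstile> subst \<theta> l : C" and "lhs_type ty l = Some T"
  shows "convertible R (subst \<theta> T) C \<and> (\<exists>s\<in>{Type, Kind}. \<Gamma> \<turnstile> subst \<theta> T : s) \<and>
    (\<forall>i A. lhs_env ty l i = Some A \<longrightarrow> \<Gamma> \<turnstile> \<theta> i : subst \<theta> A)"
  using assms(2,3)
proof (induction l arbitrary: C T)
  case (Const c)
  obtain A where A: "(c, A) \<in> set S" "convertible R A C"
    using Const.prems(1) by (auto elim: typing_ConstE)
  then obtain s where s: "[] \<turnstile> A : s" "s \<in> {Type, Kind}" and "ty c = Some A"
    using assms(1) by blast
  then have "T = A" using Const.prems(2) by simp
  moreover have "\<Gamma> \<turnstile> A : s"
    using typing_closed [OF s(1) typing_wf [OF Const.prems(1)]] s(2) closed [OF A(1)] by auto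
  ultimately show ?case using A s(2) closed by (auto simp: subst_closed)
next
  case (App f a)
  obtain A B where f: "lhs_type ty f = Some (Pi A B)" and T: "T = inst a B"
    and a: "(\<exists>i. a = Var i \<and> lhs_env ty (f \<cdot> a) = lhs_env ty f ++ [i \<mapsto> A]) \<or>
      (\<exists>T'. lhs_type ty a = Some T') \<and> lhs_env ty (f \<cdot> a) = lhs_env ty f ++ lhs_env ty a"
    using App.prems(2) by (rule lhs_type_AppE)
  obtain A' B' where f': "\<Gamma> \<turnstile> subst \<theta> f : Pi A' B'" and a': "\<Gamma> \<turnstile> subst \<theta> a : A'"
    and C: "convertible R (inst (subst \<theta> a) B') C"
    using App.prems(1) by (auto elim: typing_AppE)
  have IH: "convertible R (Pi (subst \<theta> A) (subst (upsubst \<theta>) B)) (Pi A' B')"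
    "\<exists>s\<in>{Type, Kind}. \<Gamma> \<turnstile> Pi (subst \<theta> A) (subst (upsubst \<theta>) B) : s"
    "\<forall>i A. lhs_env ty f i = Some A \<longrightarrow> \<Gamma> \<turnstile> \<theta> i : subst \<theta> A"
    using App.IH(1) [OF f' f] by simp_all
  obtain s where A: "\<Gamma> \<turnstile> subst \<theta> A : Type"
    and B: "subst \<theta> A # \<Gamma> \<turnstile> subst (upsubst \<theta>) B : s" "s \<in> {Type, Kind}"
    using IH(2) by (auto elim: typing_PiE)
  have u: "\<Gamma> \<turnstile> subst \<theta> a : subst \<theta> A"
    using wf_ctx_has_type.conv [OF a' A] equivclp_sym [OF convertible_Pi_inj(1) [OF IH(1)]] by simp
  have "\<Gamma> \<turnstile> subst \<theta> T : s"
  proof -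
    have "inst (subst \<theta> a) s = s" using B(2) by (auto simp: inst_eq)
    then show ?thesis using typing_inst [OF B(1) u] T by (simp add: subst_inst)
  qed
  moreover have "convertible R (subst \<theta> T) C"
    using convertible_inst [OF convertible_Pi_inj(2) [OF IH(1)]] C T equivclp_trans
    by (fastforce simp: subst_inst)
  moreover have "\<Gamma> \<turnstile> \<theta> i : subst \<theta> D" if "lhs_env ty (f \<cdot> a) i = Some D" for i D
    using a
  proof (elim disjE exE conjE)
    fix j assume "a = Var j" "lhs_env ty (f \<cdot> a) = lhs_env ty f ++ [j \<mapsto> A]"
    then show ?thesis using that u IH(3) by (auto split: if_splits)
  next
    fix T' assume T': "lhs_type ty a = Some T'" "lhs_env ty (f \<cdot> a) = lhs_env ty f ++ lhs_env ty a"
    then have "lhs_env ty a i = Some D \<or> lhs_env ty f i = Some D"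
      using that by (auto simp: map_add_Some_iff)
    then show ?thesis using IH(3) App.IH(2) [OF u T'(1)] by blast
  qed
  ultimately show ?case using B(2) by blast
qed simp_all

text \<open>A pattern instance is neither \<open>Type\<close> nor a product, so \<open>C\<close> is
  not \<open>Kind\<close>; it therefore has a sort and \<open>conv\<close> applies.\<close>

lemma typing_lhs_conv:
  assumes "\<Gamma> \<turnstile> subst \<theta> l : C" and "pattern l" and "\<Gamma> \<turnstile> t : A" and "convertible R A C"
  shows "\<Gamma> \<turnstile> t : C"
proof -
  have "C \<noteq> Kind"
    using assms(1,2) typing_Kind_shape subst_pattern_not(2,4) by metis
  then obtain s where "\<Gamma> \<turnstile> C : s" "s \<in> {Type, Kind}" using type_typable [OF assms(1)] by blast
  then show ?thesis using wf_ctx_has_type.conv assms(3,4) by metis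
qed

lemma preserves_typing_if_infer:
  assumes S: "\<And>c A. (c, A) \<in> set S \<Longrightarrow> ty c = Some A \<and> (\<exists>s\<in>{Type, Kind}. [] \<turnstile> A : s)"
    and "pattern l" and r: "constants r \<subseteq> declared S"
    and T: "lhs_type ty l = Some T" "infer ty (lhs_env ty l) r = Some T"
  shows "preserves_typing S R (l, r)"
  unfolding preserves_typing_def
proof (intro allI impI)
  fix \<Gamma> \<theta> C
  assume "\<Gamma> \<turnstile> subst \<theta> (fst (l, r)) : C"
  then have l: "\<Gamma> \<turnstile> subst \<theta> l : C" by simp
  have "\<exists>A s. ty c = Some A \<and> (c, A) \<in> set S \<and> [] \<turnstile> A : s \<and> s \<in> {Type, Kind}"
    if "c \<in> constants r" for c
    using r S that by (fastforce simp: declared_def)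
  then have "\<Gamma> \<turnstile> subst \<theta> r : subst \<theta> T"
    by (rule infer_sound [OF _ typing_wf [OF l] _ T(2)]) (use lhs_sound [OF S l T(1)] in auto)
  then show "\<Gamma> \<turnstile> subst \<theta> (snd (l, r)) : C"
    using typing_lhs_conv [OF l assms(2)] lhs_sound [OF S l T(1)] by simp
qed

end


subsection \<open>The system U\<close>

lemma Sig_U_distinct: "distinct (map fst Sig_U)"
  by code_simp

lemma Sig_U_closed: "(c, A) \<in> set Sig_U \<Longrightarrow> fv A = {}"
  by (auto simp: Sig_U_def lift_def)

lemma Sig_U_declared: "declared Sig_U = UNIV"
proof -
  have "c \<in> declared Sig_U" for c by (cases c) (simp_all add: declared_def Sig_U_def)
  then show ?thesis by blast
qed

text \<open>Prepares an induction along the list: a type depends on earlier constants only, and its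
  sort is found without conversion, hence independently of the rules of the fragment.\<close>

lemma Sig_U_infer:
  "\<forall>n\<in>set [0..<length Sig_U]. constants (snd (Sig_U ! n)) \<subseteq> set (map fst (take n Sig_U)) \<and>
    infer (map_of Sig_U) Map.empty (snd (Sig_U ! n)) \<in> {Some Type, Some Kind}"
  by code_simp

abbreviation fst_lhs :: utrm where
  "fst_lhs \<equiv> Const C_fst \<cdot> Var 0 \<cdot> Var 1 \<cdot> (Const C_pairdag \<cdot> Var 2 \<cdot> Var 3 \<cdot> Var 4)"

text \<open>For \<open>fst_lhs\<close> the left side gets \<open>El (Var 0)\<close> and the right
  side \<open>El (Var 2)\<close>; these agree only up to a conversion hidden in the typing of the
  instance.\<close>

lemma Rules_U_infer:
  "\<forall>(l, r)\<in>Rules_U. l = fst_lhs \<or> lhs_type (map_of Sig_U) l \<noteq> None \<and>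
    infer (map_of Sig_U) (lhs_env (map_of Sig_U) l) r = lhs_type (map_of Sig_U) l"
  by code_simp

lemma Rules_U_nonoverlapping:
  "\<forall>(l, r)\<in>Rules_U. rigid_below Rules_U l \<and>
    (\<forall>(l', r')\<in>Rules_U. (l, r) = (l', r') \<or> clash l l')"
  by code_simp

lemma Rules_U_pattern: "\<forall>(l, r)\<in>Rules_U. pattern l \<and> fv r \<subseteq> fv l"
  by (auto simp: Rules_U_def lift_def pattern_App)

text \<open>Together with \<open>convertible_rigid_inj\<close> this recovers the arguments of
  \<open>psub\<close> up to conversion, as the rule for \<open>fst\<close> requires.\<close>

lemma rigid_El_psub: "rigid Rules_U (El (psub (Var 0) (Var 1)))"
proof -
  have "rigid_below Rules_U (El (psub (Var 0) (Var 1))) \<and>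
    (\<forall>(l, r)\<in>Rules_U. clash (El (psub (Var 0) (Var 1))) l)"
    by code_simp
  then show ?thesis by (simp add: rigid_def pattern_App)
qed

section \<open>Fragments are theories\<close>

locale fragment_U =
  fixes S :: "ucon signature" and R :: "ucon rule set"
  assumes fragment: "is_fragment S R Sig_U Rules_U"
begin

lemma subsets: "set S \<subseteq> set Sig_U" "R \<subseteq> Rules_U"
  using fragment by (auto simp: is_fragment_def)

text \<open>Orthogonality and closedness are universal statements about rules and declarations, so
  they descend from the full system.\<close>

sublocale orthogonal_system S R
proof
  fix l r
  assume lr: "(l, r) \<in> R"
  then have U: "(l, r) \<in> Rules_U" using subsets by blast
  show "pattern l" "fv r \<subseteq> fv l" using Rules_U_pattern U by auto
  show "rigid_below R l"
    using Rules_U_nonoverlapping U subsets(2) by (auto intro: rigid_below_antimono)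
  show "(l, r) = (l', r') \<or> clash l l'" if "(l', r') \<in> R" for l' r'
    using bspec [OF Rules_U_nonoverlapping U] subsetD [OF subsets(2) that] by fastforce
next
  show "fv A = {}" if "(c, A) \<in> set S" for c A
    using Sig_U_closed subsets(1) that by blast
qed

text \<open>Names in \<open>Sig_U\<close> are distinct, so one lookup function serves all fragments,
  whatever the order of the list \<open>S\<close>.\<close>

lemma lookup: "(c, A) \<in> set S \<Longrightarrow> map_of Sig_U c = Some A"
  using subsets(1) Sig_U_distinct by auto

text \<open>Induction on the position in \<open>Sig_U\<close>: the fragment declares all constants
  of the type, and these sit at earlier positions, so their types are already typable in the
  fragment.\<close>

lemma declared_typable:
  "n < length Sig_U \<Longrightarrow> Sig_U ! n \<in> set S \<Longrightarrow> \<exists>s\<in>{Type, Kind}. [] \<turnstile> snd (Sig_U ! n) : s"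
proof (induction n rule: less_induct)
  case (less n)
  let ?A = "snd (Sig_U ! n)"
  obtain s where s: "infer (map_of Sig_U) Map.empty ?A = Some s" "s \<in> {Type, Kind}"
    and earlier: "constants ?A \<subseteq> set (map fst (take n Sig_U))"
    using Sig_U_infer less.prems(1) by fastforce
  have declared: "constants ?A \<subseteq> declared S"
    using fragment less.prems(2) by (force simp: is_fragment_def)
  have "[] \<turnstile> subst Var ?A : subst Var s"
  proof (rule infer_sound [where P = Map.empty and ty = "map_of Sig_U"])
    fix c assume c: "c \<in> constants ?A"
    then obtain m where m: "m < n" "m < length Sig_U" "c = fst (Sig_U ! m)"
      using subsetD [OF earlier c] unfolding in_set_conv_nth by auto
    obtain A where A: "(c, A) \<in> set S" using c declared by (auto simp: declared_def)
    have "A = snd (Sig_U ! m)"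
      using lookup [OF A] m map_of_is_SomeI [OF Sig_U_distinct, of c "snd (Sig_U ! m)"] by simp
    then show "\<exists>A s. map_of Sig_U c = Some A \<and> (c, A) \<in> set S \<and> [] \<turnstile> A : s \<and> s \<in> {Type, Kind}"
      using less.IH [of m] m A lookup [OF A] by auto
  qed (use s wf_ctx_has_type.empty in auto)
  then show ?case using s(2) by auto
qed

lemma signature_ok:
  "(c, A) \<in> set S \<Longrightarrow> map_of Sig_U c = Some A \<and> (\<exists>s\<in>{Type, Kind}. [] \<turnstile> A : s)"
proof -
  assume cA: "(c, A) \<in> set S"
  then obtain n where "n < length Sig_U" "Sig_U ! n = (c, A)"
    using subsets(1) by (metis in_set_conv_nth subsetD)
  then show ?thesis using declared_typable [of n] lookup cA by simp
qed

text \<open>The domain \<open>A\<close> expected by the typed instance of \<open>fst\<close> is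
  convertible to both \<open>El (psub (\<theta> 0) (\<theta> 1))\<close> and
  \<open>El (psub (\<theta> 2) (\<theta> 3))\<close>. Rigidity makes \<open>\<theta> 0\<close> and
  \<open>\<theta> 2\<close> convertible, so \<open>\<theta> 4\<close> of type
  \<open>El (\<theta> 2)\<close> gets the right type.\<close>

lemma preserves_typing_fst:
  assumes "(fst_lhs, r) \<in> R"
  shows "preserves_typing S R (fst_lhs, r)"
  unfolding preserves_typing_def
proof (intro allI impI)
  fix \<Gamma> and \<theta> :: "nat \<Rightarrow> utrm" and C
  let ?ty = "map_of Sig_U"
  let ?f = "Const C_fst \<cdot> Var 0 \<cdot> Var 1 :: utrm"
  let ?p = "Const C_pairdag \<cdot> Var 2 \<cdot> Var 3 \<cdot> Var 4 :: utrm"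
  \<comment> \<open>The shift by two presents \<open>El (psub (\<theta> 2) (\<theta> 3))\<close> as
    an instance of the same pattern over \<open>Var 0\<close> and \<open>Var 1\<close>.\<close>
  let ?\<sigma> = "\<lambda>i. \<theta> (i + 2)"
  have types: "lhs_type ?ty ?f = Some (El (psub (Var 0) (Var 1)) \<rightarrow> El (Var 0))"
    "lhs_type ?ty ?p = Some (El (psub (Var 2) (Var 3)))"
    "lhs_type ?ty fst_lhs = Some (El (Var 0))"
    "lhs_env ?ty ?p 4 = Some (El (Var 2))"
    by code_simp+
  assume "\<Gamma> \<turnstile> subst \<theta> (fst (fst_lhs, r)) : C"
  then have l: "\<Gamma> \<turnstile> subst \<theta> fst_lhs : C" by simp
  then obtain A B where f: "\<Gamma> \<turnstile> subst \<theta> ?f : Pi A B" and p: "\<Gamma> \<turnstile> subst \<theta> ?p : A"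
    by (auto elim: typing_AppE)
  have "convertible R (El (psub (\<theta> 0) (\<theta> 1))) A"
    using lhs_sound [OF signature_ok f types(1)] convertible_Pi_inj(1) by fastforce
  moreover have "convertible R (El (psub (\<theta> 2) (\<theta> 3))) A"
    using lhs_sound [OF signature_ok p types(2)] by simp
  ultimately have "convertible R (subst ?\<sigma> (El (psub (Var 0) (Var 1))))
      (subst \<theta> (El (psub (Var 0) (Var 1))))"
    by (auto simp: numeral_3_eq_3 numeral_2_eq_2 intro: equivclp_sym equivclp_trans)
  then have "convertible R (?\<sigma> 0) (\<theta> 0)"
    by (rule convertible_rigid_inj [OF rigid_antimono [OF rigid_El_psub subsets(2)]]) simp
  then have conv: "convertible R (El (\<theta> 2)) (El (\<theta> 0))"
    by (simp add: convertible_App_arg numeral_2_eq_2)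
  have m: "\<Gamma> \<turnstile> \<theta> 4 : El (\<theta> 2)"
    using lhs_sound [OF signature_ok p types(2)] types(4) by fastforce
  have C: "convertible R (El (\<theta> 0)) C"
    using lhs_sound [OF signature_ok l types(3)] by simp
  have "r = Var 4" using assms subsets(2) by (auto simp: Rules_U_def)
  then show "\<Gamma> \<turnstile> subst \<theta> (snd (fst_lhs, r)) : C"
    using typing_lhs_conv [OF l _ m equivclp_trans [OF conv C]] by (simp add: pattern_App)
qed

lemma theory_U: "is_theory S R"
proof -
  have system: "is_system S R" using fragment by (simp add: is_fragment_def)
  have "preserves_typing S R (l, r)" if lr: "(l, r) \<in> R" for l r
  proof (cases "l = fst_lhs")
    case True
    then show ?thesis using preserves_typing_fst lr by blast
  next
    case False
    have "(l, r) \<in> Rules_U" using lr subsets(2) by blast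
    then have "lhs_type (map_of Sig_U) l \<noteq> None"
      "infer (map_of Sig_U) (lhs_env (map_of Sig_U) l) r = lhs_type (map_of Sig_U) l"
      using Rules_U_infer False by auto
    moreover have "constants r \<subseteq> declared S"
      using system lr by (auto simp: is_system_def Lambda_def)
    ultimately show ?thesis
      using preserves_typing_if_infer [OF signature_ok pattern_lhs [OF lr]] by fastforce
  qed
  moreover have "confluent_on (Lambda S) (step R)"
    using confluentpD [OF confluentp_step] by (simp add: confluent_on_def)
  ultimately show ?thesis using system by (auto simp: is_theory_def)
qed

end

text \<open>\<open>Sig_U\<close> declares every constant, so the closure conditions hold at once;
  \<open>pattern_spine\<close> gives the required shape of the left-hand sides.\<close>

lemma fragment_refl: "is_fragment Sig_U Rules_U Sig_U Rules_U"
proof -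
  have "is_system Sig_U Rules_U"
    using Rules_U_pattern Sig_U_closed
    by (fastforce simp: is_system_def Lambda_def Sig_U_declared intro: pattern_spine)
  then show ?thesis by (auto simp: is_fragment_def Sig_U_declared)
qed

theorem theorem4p7:
  "(\<forall>S1 R1. is_fragment S1 R1 Sig_U Rules_U \<longrightarrow> is_theory S1 R1) \<and>
   is_theory Sig_U Rules_U"
  using fragment_U.theory_U fragment_refl by (blast intro: fragment_U.intro)

end
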